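(* Let $\pi$ be a triod twist pattern with rotation number $\rho<\frac13$, the branches of the triod $T$ being numbered canonically for $\pi$. Then $\pi$ has no red points (i.e. no cycle exhibiting $\pi$ has a red point).
   Context: The triod is $T=\{z\in\mathbb{C}: z^3\in[0,1]\}$, with central (branching) point $a=0$; the branches of $T$ are the three components of $T\setminus\{a\}$. Let $\mathcal{U}$ be the set of continuous maps $f:T\to T$ for which $a$ is the unique fixed point. A cycle is a periodic orbit $P\neq\{a\}$ of some $f\in\mathcal{U}$; $[P]$ is its convex hull in $T$. Cycles $P$ of $f$ and $Q$ of $g$ are equivalent if there is a homeomorphism $h:[P]\to[Q]$ with $h(P)=Q$ and $h\circ f=g\circ h$ on $P$, which fixes branches (points of each branch are sent into the same branch). The equivalence class of $P$ is its pattern, and $P$ exhibits that pattern. A pattern $A$ forces a pattern $B$ if every $f\in\mathcal{U}$ with a cycle of pattern $A$ also has a cycle of pattern $B$. A cycle and its pattern are primitive if each point of the cycle lies on a different branch. A pattern is regular if it does not force a primitive pattern of period $2$; a cycle is regular if its pattern is. Number the branches $b_0,b_1,b_2$ (indices mod $3$). For $u\in b_i$, $v\in b_j$ put $d(u,v)=\frac k3$, where $k\in\{0,1,2\}$ and $j\equiv i+k \pmod 3$. For a cycle $P$ of $f$, a point $x\in P$ is green, black or red according as $d(x,f(x))=0,\frac13,\frac23$. If $P$ has period $n$, its rotation pair is $\left(\sum_{i=0}^{n-1}d(f^i(x),f^{i+1}(x)),\,n\right)$ for $x\in P$ (the first entry is an integer), and its rotation number is the quotient of the first entry by the second; these depend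 only on the pattern. The numbering is canonical for a regular cycle (or its pattern) if, for each $i$, the point of the cycle on $b_i$ closest to $a$ is black; every regular cycle admits a canonical numbering. All rotation numbers are computed with the fixed numbering. A triod twist is a regular pattern that does not force another pattern with the same rotation number. *)

theory Defs
  imports "HOL-Analysis.Analysis"
begin

definition triod :: "complex set" where
  "triod = {z. z ^ 3 \<in> complex_of_real ` {0..1}}"

definition branches :: "complex set set" where
  "branches = components (triod - {0})"

text \<open>Maps of the triod are represented by functions on all of \<^typ>\<open>complex\<close>; their values
  outside \<^const>\<open>triod\<close> play no role.\<close>

definition triod_maps :: "(complex \<Rightarrow> complex) set" where
  "triod_maps = {f. continuous_on triod f \<and> f ` triod \<subseteq> triod \<and> {x \<in> triod. f x = x} = {0}}"

definition periodic_orbit :: "(complex \<Rightarrow> complex) \<Rightarrow> complex set \<Rightarrow> bool" where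
  "periodic_orbit f P \<longleftrightarrow>
     (\<exists>x\<in>triod. \<exists>n>0. (f ^^ n) x = x \<and> P = range (\<lambda>i. (f ^^ i) x))"

text \<open>A cycle is recorded together with its map, since its pattern depends on the action of the
  map on the orbit.\<close>

type_synonym triod_cycle = "(complex \<Rightarrow> complex) \<times> complex set"

definition cycles :: "triod_cycle set" where
  "cycles = {(f, P). f \<in> triod_maps \<and> periodic_orbit f P \<and> P \<noteq> {0}}"

text \<open>The convex hull in the triod, i.e. the smallest connected subset containing \<open>P\<close>.\<close>

definition triod_hull :: "complex set \<Rightarrow> complex set" where
  "triod_hull P = \<Inter>{C. connected C \<and> P \<subseteq> C \<and> C \<subseteq> triod}"

definition cycle_equiv :: "(triod_cycle \<times> triod_cycle) set" where
  "cycle_equiv = {((f, P), (g, Q)). (f, P) \<in> cycles \<and> (g, Q) \<in> cycles \<and>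
     (\<exists>h k. homeomorphism (triod_hull P) (triod_hull Q) h k \<and> h ` P = Q \<and>
        (\<forall>x\<in>P. h (f x) = g (h x)) \<and>
        (\<forall>c\<in>branches. h ` (triod_hull P \<inter> c) \<subseteq> c))}"

type_synonym triod_pattern = "triod_cycle set"

definition patterns :: "triod_pattern set" where
  "patterns = cycles // cycle_equiv"

definition forces :: "triod_pattern \<Rightarrow> triod_pattern \<Rightarrow> bool" where
  "forces A B \<longleftrightarrow> (\<forall>f\<in>triod_maps. (\<exists>P. (f, P) \<in> A) \<longrightarrow> (\<exists>Q. (f, Q) \<in> B))"

definition primitive_cycle :: "complex set \<Rightarrow> bool" where
  "primitive_cycle P \<longleftrightarrow> (\<forall>c\<in>branches. \<forall>x\<in>P \<inter> c. \<forall>y\<in>P \<inter> c. x = y)"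

text \<open>Notions that depend only on the pattern are transferred from cycles to patterns by
  requiring them of all cycles in the (nonempty) equivalence class.\<close>

definition primitive_pattern :: "triod_pattern \<Rightarrow> bool" where
  "primitive_pattern A \<longleftrightarrow> (\<forall>(f, P)\<in>A. primitive_cycle P)"

definition has_period :: "triod_pattern \<Rightarrow> nat \<Rightarrow> bool" where
  "has_period A n \<longleftrightarrow> (\<forall>(f, P)\<in>A. card P = n)"

definition regular_pattern :: "triod_pattern \<Rightarrow> bool" where
  "regular_pattern A \<longleftrightarrow>
     \<not> (\<exists>B\<in>patterns. primitive_pattern B \<and> has_period B 2 \<and> forces A B)"

text \<open>A numbering is an arbitrary bijection, so both cyclic orders of the branches occur. Only the
  values at \<open>0\<close>, \<open>1\<close>, \<open>2\<close> are used.\<close>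

definition branch_numbering :: "(nat \<Rightarrow> complex set) \<Rightarrow> bool" where
  "branch_numbering b \<longleftrightarrow> bij_betw b {..<3} branches"

text \<open>Meaningful only for \<open>u\<close>, \<open>v\<close> distinct from the branching point; no cycle contains it.\<close>

definition displacement :: "(nat \<Rightarrow> complex set) \<Rightarrow> complex \<Rightarrow> complex \<Rightarrow> real" where
  "displacement b u v =
     real (THE k. k < 3 \<and> (\<exists>i<3. \<exists>j<3. u \<in> b i \<and> v \<in> b j \<and> j = (i + k) mod 3)) / 3"

definition black :: "(nat \<Rightarrow> complex set) \<Rightarrow> (complex \<Rightarrow> complex) \<Rightarrow> complex \<Rightarrow> bool" where
  "black b f x \<longleftrightarrow> displacement b x (f x) = 1 / 3"

definition red :: "(nat \<Rightarrow> complex set) \<Rightarrow> (complex \<Rightarrow> complex) \<Rightarrow> complex \<Rightarrow> bool" where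
  "red b f x \<longleftrightarrow> displacement b x (f x) = 2 / 3"

text \<open>The sum runs once around the orbit, so the choice of the starting point is immaterial.\<close>

definition rotation_pair ::
    "(nat \<Rightarrow> complex set) \<Rightarrow> (complex \<Rightarrow> complex) \<Rightarrow> complex set \<Rightarrow> real \<times> nat" where
  "rotation_pair b f P =
     (let x = (SOME x. x \<in> P); n = card P
      in (\<Sum>i<n. displacement b ((f ^^ i) x) ((f ^^ Suc i) x), n))"

definition rotation_number ::
    "(nat \<Rightarrow> complex set) \<Rightarrow> (complex \<Rightarrow> complex) \<Rightarrow> complex set \<Rightarrow> real" where
  "rotation_number b f P = fst (rotation_pair b f P) / real (snd (rotation_pair b f P))"

text \<open>Equivalent cycles have the same rotation number, so the image below is a singleton for every
  pattern.\<close>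

definition pattern_rotation_number :: "(nat \<Rightarrow> complex set) \<Rightarrow> triod_pattern \<Rightarrow> real" where
  "pattern_rotation_number b A = the_elem ((\<lambda>(f, P). rotation_number b f P) ` A)"

definition canonical_cycle ::
    "(nat \<Rightarrow> complex set) \<Rightarrow> (complex \<Rightarrow> complex) \<Rightarrow> complex set \<Rightarrow> bool" where
  "canonical_cycle b f P \<longleftrightarrow>
     (\<forall>i<3. \<exists>x\<in>P \<inter> b i. (\<forall>y\<in>P \<inter> b i. dist 0 x \<le> dist 0 y) \<and> black b f x)"

definition canonical_pattern :: "(nat \<Rightarrow> complex set) \<Rightarrow> triod_pattern \<Rightarrow> bool" where
  "canonical_pattern b A \<longleftrightarrow> (\<forall>(f, P)\<in>A. canonical_cycle b f P)"

definition triod_twist :: "(nat \<Rightarrow> complex set) \<Rightarrow> triod_pattern \<Rightarrow> bool" where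
  "triod_twist b A \<longleftrightarrow> A \<in> patterns \<and> regular_pattern A \<and>
     \<not> (\<exists>B\<in>patterns. B \<noteq> A \<and> forces A B \<and>
          pattern_rotation_number b B = pattern_rotation_number b A)"

end

theory Submission
  imports Defs
begin

text \<open>Let \<open>P\<close> be a cycle with the given pattern and call \<open>y\<close> \<^emph>\<open>below\<close> \<open>z\<close> if it lies between the branching
  point and \<open>z\<close>. A closed walk in \<open>P\<close> whose every vertex is below the image of the previous one
  is tracked, in each map with that pattern, by a periodic orbit visiting the same branches, and
  the pattern of this orbit does not depend on the map, so it is forced. Hence regularity excludes
  closed walks of length two between different branches.

  Let \<open>L\<close> be the function on \<open>P\<close> with \<open>L (f x) = L x + d(x, f x) - \<rho>\<close>. It is strictly increasing
  along each branch: if \<open>f\<^sup>k x\<close> is farther out than \<open>x\<close> and \<open>L\<close> does not increase, then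
  \<open>x, f x, \<dots>, f\<^sup>k\<^sup>-\<^sup>1 x\<close> is a closed walk of rotation number at most \<open>\<rho>\<close>, and combining it with the
  walk through the three points closest to the branching point, of rotation number \<open>1/3 > \<rho>\<close>, gives
  a walk of rotation number \<open>\<rho>\<close> that forces another pattern.

  Finally let \<open>y\<close> be a red point with \<open>L y\<close> minimal. The point of \<open>P\<close> closest to the branching
  point on the branch of \<open>y\<close> has a smaller value of \<open>L\<close>, and since there are no closed walks of
  length two, its orbit stays in a set of points with small \<open>L\<close> that does not contain \<open>y\<close>.\<close>

section \<open>Geometry of the triod\<close>

text \<open>Forcing quantifies over all maps with the pattern, and these are arbitrary continuous
  maps between the points of the cycle. So the order of a tracking orbit on each branch has to be
  determined by the walk alone. Lowering a walk to the minimal one with the same branches makes the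
  interval just below each vertex cover the next such interval. Different vertices on a branch have
  disjoint intervals; at equal vertices the choice of first hits passes the comparison on to the
  next step, and periodicity decides it.

  Two degenerations have to be kept away. The tracking orbit must not collapse to the branching
  point: closest points are black, so a step of another colour pushes some vertex off them. And its
  itinerary must not be that of a point of \<open>P\<close>: this takes a counting argument, by the
  period for short walks and by a run of \<open>card P\<close> black points for the combined walk.
  Such a run cannot occur in a cycle with rotation number below 1/3, which is why copies of the
  black triangle are added in bulk.\<close>

definition dirs :: "complex set" where
  "dirs = {e. e ^ 3 = 1}"

definition ray :: "complex \<Rightarrow> complex set" where
  "ray e = (\<lambda>r. of_real r * e) ` {0<..1}"

text \<open>The retraction of the triod onto \<open>ray e\<close>, in the radial coordinate: the other two branches are
  at an angle of more than \<open>\<pi> / 2\<close> and go to \<open>0\<close>.\<close>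

definition ret :: "complex \<Rightarrow> complex \<Rightarrow> real" where
  "ret e z = max 0 (Re (z * cnj e))"

lemma finite_dirs [simp]: "finite dirs"
  unfolding dirs_def by (rule finite_nth_roots) simp

lemma norm_dirs [simp]: "e \<in> dirs \<Longrightarrow> norm e = 1"
proof -
  assume "e \<in> dirs"
  then have "norm e ^ 3 = 1"
    by (simp add: dirs_def flip: norm_power)
  then show "norm e = 1"
    using power_eq_imp_eq_base[of "norm e" 3 1] by simp
qed

lemma dirs_cnj: "e \<in> dirs \<Longrightarrow> e * cnj e = 1"
  by (simp add: complex_norm_square[symmetric])

text \<open>The quotient \<open>w\<close> of two distinct cube roots of unity is a primitive one:
  \<open>w^2 + w + 1 = 0\<close>, and \<open>w^2\<close> is the conjugate of
  \<open>w\<close>.\<close>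

lemma Re_dirs_mult_cnj:
  assumes "e \<in> dirs" "e' \<in> dirs" "e \<noteq> e'"
  shows "Re (e * cnj e') = - 1 / 2"
proof -
  define w where "w = e * cnj e'"
  have w3: "w ^ 3 = 1"
    using assms by (simp add: w_def dirs_def power_mult_distrib flip: complex_cnj_power)
  have "w \<noteq> 1"
  proof
    assume "w = 1"
    then have "e * (cnj e' * e') = e'"
      unfolding w_def by (simp add: mult.assoc[symmetric])
    then show False using dirs_cnj[OF assms(2)] assms(3)
      by (simp add: mult.commute)
  qed
  have "(w - 1) * (w\<^sup>2 + w + 1) = 0"
    using w3 by (simp add: algebra_simps power2_eq_square power3_eq_cube)
  with \<open>w \<noteq> 1\<close> have "w\<^sup>2 + w + 1 = 0"
    by simp
  moreover have "w \<in> dirs"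
    using w3 by (simp add: dirs_def)
  then have "w * cnj w = 1"
    by (rule dirs_cnj)
  then have "w\<^sup>2 * cnj w = w" "w ^ 3 * cnj w = w\<^sup>2"
    by (simp_all add: power2_eq_square power3_eq_cube mult.assoc)
  then have "cnj w = w\<^sup>2"
    using w3 by simp
  ultimately have "cnj w + w + 1 = 0"
    by simp
  then have "Re (cnj w + w + 1) = 0"
    by simp
  then show ?thesis
    unfolding w_def[symmetric] by simp
qed

lemma dirs_sgn [simp]: "e \<in> dirs \<Longrightarrow> sgn e = e"
  by (simp add: sgn_div_norm)

lemma dirs_nonzero [simp]: "e \<in> dirs \<Longrightarrow> e \<noteq> 0"
  by (auto simp: dirs_def)

lemma norm_mult_sgn: "of_real (norm z) * sgn z = (z :: complex)"
  by (simp add: sgn_eq)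

lemma sgn_of_real_mult_dirs: "e \<in> dirs \<Longrightarrow> r > 0 \<Longrightarrow> sgn (of_real r * e) = e"
  by (simp add: sgn_mult sgn_of_real)

lemma norm_of_real_mult_dirs: "e \<in> dirs \<Longrightarrow> r \<ge> 0 \<Longrightarrow> norm (of_real r * e) = r"
  by (simp add: norm_mult)

lemma triod_iff: "z \<in> triod \<longleftrightarrow> z = 0 \<or> (sgn z \<in> dirs \<and> norm z \<le> 1)"
proof (cases "z = 0")
  case True
  then show ?thesis by (auto simp: triod_def intro!: image_eqI[of _ _ 0])
next
  case False
  have z3: "z ^ 3 = of_real (norm z ^ 3) * sgn z ^ 3"
    by (metis norm_mult_sgn of_real_power power_mult_distrib)
  show ?thesis
  proof
    assume "z \<in> triod"
    then obtain t where t: "z ^ 3 = of_real t" "0 \<le> t" "t \<le> 1"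
      by (auto simp: triod_def)
    then have n3: "norm z ^ 3 = t"
      by (metis abs_of_nonneg norm_of_real norm_power)
    then have "sgn z ^ 3 = 1"
      using z3 t False by auto
    moreover have "norm z \<le> 1"
      using n3 t(3) power_le_imp_le_base[of "norm z" 2 1] by (simp add: eval_nat_numeral)
    ultimately show "z = 0 \<or> (sgn z \<in> dirs \<and> norm z \<le> 1)"
      by (simp add: dirs_def)
  next
    assume "z = 0 \<or> (sgn z \<in> dirs \<and> norm z \<le> 1)"
    with False have s3: "sgn z ^ 3 = 1" and "norm z \<le> 1"
      by (auto simp: dirs_def)
    have "z ^ 3 = of_real (norm z ^ 3)"
      by (subst z3) (simp add: s3)
    moreover have "norm z ^ 3 \<le> 1"
      using \<open>norm z \<le> 1\<close> by (simp add: power_le_one)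
    ultimately show "z \<in> triod"
      unfolding triod_def by (intro CollectI image_eqI[of _ _ "norm z ^ 3"]) auto
  qed
qed

lemma zero_in_triod [simp]: "0 \<in> triod"
  by (simp add: triod_iff)

lemma ray_iff: "e \<in> dirs \<Longrightarrow> z \<in> ray e \<longleftrightarrow> z \<in> triod - {0} \<and> sgn z = e"
  unfolding ray_def
  by (auto simp: triod_iff sgn_of_real_mult_dirs norm_of_real_mult_dirs norm_mult_sgn
      intro!: image_eqI[of _ _ "norm z"])

lemma of_real_mult_dirs_in_triod: "e \<in> dirs \<Longrightarrow> 0 \<le> r \<Longrightarrow> r \<le> 1 \<Longrightarrow> of_real r * e \<in> triod"
  by (cases "r = 0") (auto simp: triod_iff sgn_of_real_mult_dirs norm_of_real_mult_dirs)

lemma connected_ray: "connected (ray e)"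
  unfolding ray_def by (intro connected_continuous_image continuous_intros) auto

text \<open>Away from the branching point \<open>sgn\<close> is continuous and takes only finitely
  many values.\<close>

lemma sgn_const_on_connected:
  assumes "connected C" "C \<subseteq> triod - {0}" "z \<in> C" "w \<in> C"
  shows "sgn z = sgn w"
proof -
  have "continuous_on C (\<lambda>z. of_real (inverse (norm z)) * z)"
    using assms(2) by (intro continuous_intros) auto
  then have "continuous_on C sgn"
    by (simp add: sgn_div_norm scaleR_conv_of_real)
  moreover have "sgn ` C \<subseteq> dirs"
    using assms(2) by (auto simp: triod_iff)
  then have "finite (sgn ` C)"
    using finite_dirs finite_subset by blast
  ultimately have "sgn constant_on C"
    using continuous_finite_range_constant assms(1) by blast
  then show ?thesis
    using assms by (auto simp: constant_on_def)
qed

lemma branches_eq: "branches = ray ` dirs"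
proof -
  have comp: "connected_component_set (triod - {0}) z = ray (sgn z)" if "z \<in> triod - {0}" for z
  proof
    have "sgn z \<in> dirs" using that by (auto simp: triod_iff)
    show "connected_component_set (triod - {0}) z \<subseteq> ray (sgn z)"
    proof
      fix w assume w: "w \<in> connected_component_set (triod - {0}) z"
      then have "sgn z = sgn w"
        using sgn_const_on_connected[of "connected_component_set (triod - {0}) z" z w]
          connected_component_subset[of "triod - {0}" z] that by auto
      then show "w \<in> ray (sgn z)"
        using w connected_component_subset[of "triod - {0}" z] \<open>sgn z \<in> dirs\<close>
        by (auto simp: ray_iff)
    qed
    show "ray (sgn z) \<subseteq> connected_component_set (triod - {0}) z"
      using \<open>sgn z \<in> dirs\<close> that
      by (intro connected_component_maximal connected_ray) (auto simp: ray_iff)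
  qed
  show ?thesis
  proof
    show "branches \<subseteq> ray ` dirs"
    proof
      fix c assume "c \<in> branches"
      then obtain z where "z \<in> triod - {0}" "c = connected_component_set (triod - {0}) z"
        by (auto simp: branches_def components_def)
      then show "c \<in> ray ` dirs"
        using comp[of z] by (auto simp: triod_iff)
    qed
    show "ray ` dirs \<subseteq> branches"
    proof
      fix c assume "c \<in> ray ` dirs"
      then obtain e where e: "e \<in> dirs" "c = ray e" by auto
      then have "e \<in> triod - {0}" by (auto simp: triod_iff)
      then show "c \<in> branches"
        using comp[of e] e unfolding branches_def components_def by (metis dirs_sgn image_eqI)
    qed
  qed
qed

lemma sgn_in_dirs: "z \<in> triod \<Longrightarrow> z \<noteq> 0 \<Longrightarrow> sgn z \<in> dirs"
  by (auto simp: triod_iff)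

lemma triod_norm_le: "z \<in> triod \<Longrightarrow> norm z \<le> 1"
  by (auto simp: triod_iff)

lemma continuous_on_ret [continuous_intros]:
  "continuous_on S g \<Longrightarrow> continuous_on S (\<lambda>x. ret e (g x))"
  unfolding ret_def by (intro continuous_intros)

lemma ret_nonneg [simp]: "ret e z \<ge> 0"
  by (simp add: ret_def)

lemma ret_zero [simp]: "ret e 0 = 0"
  by (simp add: ret_def)

lemma ret_eq:
  assumes "e \<in> dirs" "z \<in> triod"
  shows "ret e z = (if sgn z = e then norm z else 0)"
proof (cases "z = 0")
  case False
  then have s: "sgn z \<in> dirs" using assms by (simp add: sgn_in_dirs)
  have "of_real (norm z) * (sgn z * cnj e) = z * cnj e"
    by (simp only: mult.assoc[symmetric] norm_mult_sgn)
  then have *: "Re (z * cnj e) = norm z * Re (sgn z * cnj e)"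
    by (metis Re_complex_of_real Im_complex_of_real diff_zero mult_zero_left times_complex.sel(1))
  show ?thesis
  proof (cases "sgn z = e")
    case True
    then have "Re (sgn z * cnj e) = 1"
      using dirs_cnj[OF assms(1)] by simp
    then show ?thesis
      using * True by (simp add: ret_def)
  next
    case ne: False
    then show ?thesis
      using * Re_dirs_mult_cnj[OF s assms(1) ne] by (simp add: ret_def)
  qed
qed auto

lemma complex_eqI_sgn_norm: "sgn z = sgn w \<Longrightarrow> norm z = norm w \<Longrightarrow> z = (w :: complex)"
  by (metis norm_mult_sgn)

section \<open>Equivalence of cycles in terms of the order on the branches\<close>

definition star :: "complex set \<Rightarrow> complex set" where
  "star Q = {z \<in> triod. z = 0 \<or> (\<exists>x\<in>Q. sgn x = sgn z \<and> norm z \<le> norm x)}"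

text \<open>The hull of a set on a single branch is an interval that avoids the branching point, and
  a homeomorphism of it may reverse the order. A second branch puts 0 into the hull and excludes
  this.\<close>

definition spread :: "complex set \<Rightarrow> bool" where
  "spread Q \<longleftrightarrow> Q \<subseteq> triod - {0} \<and> (\<exists>x\<in>Q. \<exists>y\<in>Q. sgn x \<noteq> sgn y)"

lemma connected_star: "connected (star Q)"
proof (rule starlike_imp_connected)
  have "closed_segment 0 z \<subseteq> star Q" if z: "z \<in> star Q" for z
  proof
    fix w assume "w \<in> closed_segment 0 z"
    then obtain t where t: "0 \<le> t" "t \<le> 1" "w = t *\<^sub>R z"
      by (auto simp: closed_segment_def)
    show "w \<in> star Q"
    proof (cases "w = 0")
      case False
      then have "t > 0" "z \<noteq> 0"
        using t by auto
      then have "sgn w = sgn z" "norm w \<le> norm z"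
        using t by (auto simp: sgn_scaleR mult_left_le_one_le)
      then show ?thesis
        using z \<open>z \<noteq> 0\<close> by (fastforce simp: star_def triod_iff)
    qed (simp add: star_def)
  qed
  moreover have "0 \<in> star Q"
    by (simp add: star_def)
  ultimately show "starlike (star Q)"
    unfolding starlike_def by blast
qed

text \<open>A connected set that avoids 0 stays on one branch, so every competitor in the hull
  contains 0. Its retraction to a branch is then an interval from 0 past every point of
  \<open>Q\<close> there.\<close>

lemma triod_hull_eq_star:
  assumes "spread Q"
  shows "triod_hull Q = star Q"
proof
  have "Q \<subseteq> star Q" "star Q \<subseteq> triod"
    using assms by (auto simp: star_def spread_def)
  then show "triod_hull Q \<subseteq> star Q"
    unfolding triod_hull_def using connected_star by blast
  show "star Q \<subseteq> triod_hull Q"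
    unfolding triod_hull_def
  proof (intro Inter_greatest subsetI)
    fix C z assume C: "C \<in> {C. connected C \<and> Q \<subseteq> C \<and> C \<subseteq> triod}" and z: "z \<in> star Q"
    have C0: "0 \<in> C"
    proof (rule ccontr)
      assume "0 \<notin> C"
      then have "C \<subseteq> triod - {0}" "connected C" "Q \<subseteq> C"
        using C by auto
      then show False
        using sgn_const_on_connected assms unfolding spread_def by blast
    qed
    show "z \<in> C"
    proof (cases "z = 0")
      case False
      then obtain x where x: "x \<in> Q" "sgn x = sgn z" "norm z \<le> norm x" and zt: "z \<in> triod"
        using z by (auto simp: star_def)
      define e where "e = sgn z"
      have e: "e \<in> dirs" using zt False by (simp add: e_def sgn_in_dirs)
      have xC: "x \<in> C" "x \<in> triod" using x C by auto
      have "connected (ret e ` C)"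
        using C by (intro connected_continuous_image continuous_on_ret continuous_on_id) auto
      moreover have "0 \<in> ret e ` C" using C0 by (metis image_eqI ret_zero)
      moreover have "norm x \<in> ret e ` C"
        using xC x e by (intro image_eqI[of _ _ x]) (auto simp: ret_eq e_def)
      ultimately have "norm z \<in> ret e ` C"
        using x(3) connectedD_interval[of "ret e ` C" 0 "norm x" "norm z"] by auto
      then obtain w where w: "w \<in> C" "norm z = ret e w" by auto
      then have "sgn w = e" "norm w = norm z"
        using False C e ret_eq[of e w] by (auto split: if_splits)
      then show ?thesis
        using w(1) complex_eqI_sgn_norm[of z w] by (simp add: e_def)
    qed (use C0 in simp)
  qed
qed

text \<open>The trace on the cycle of a homeomorphism of hulls. For \<open>spread\<close> cycles it
  carries the same information as \<open>cycle_equiv\<close>, and all later arguments work with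
  it.\<close>

definition cycle_iso ::
    "(complex \<Rightarrow> complex) \<Rightarrow> (complex \<Rightarrow> complex) \<Rightarrow> complex set \<Rightarrow> (complex \<Rightarrow> complex) \<Rightarrow> complex set \<Rightarrow> bool"
  where
  "cycle_iso h f P g Q \<longleftrightarrow> bij_betw h P Q \<and>
     (\<forall>x\<in>P. h (f x) = g (h x) \<and> sgn (h x) = sgn x) \<and>
     (\<forall>x\<in>P. \<forall>y\<in>P. sgn x = sgn y \<longrightarrow> norm x < norm y \<longrightarrow> norm (h x) < norm (h y))"

lemma cycle_isoI_equiv:
  assumes E: "((f, P), (g, Q)) \<in> cycle_equiv" and P: "spread P" and Q0: "Q \<subseteq> triod - {0}"
  shows "\<exists>h. cycle_iso h f P g Q"
proof -
  obtain h k where hom: "homeomorphism (triod_hull P) (triod_hull Q) h k" and hPQ: "h ` P = Q"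
    and conj: "\<forall>x\<in>P. h (f x) = g (h x)"
    and br: "\<forall>c\<in>branches. h ` (triod_hull P \<inter> c) \<subseteq> c"
    using E unfolding cycle_equiv_def by auto
  have PP: "P \<subseteq> triod - {0}" using P by (simp add: spread_def)
  have sP: "triod_hull P = star P" using P by (rule triod_hull_eq_star)
  have sg: "sgn (h z) = sgn z" "h z \<in> triod - {0}" if "z \<in> star P" "z \<noteq> 0" for z
  proof -
    have "z \<in> triod" using that by (simp add: star_def)
    then have "sgn z \<in> dirs" using that by (simp add: sgn_in_dirs)
    then have "ray (sgn z) \<in> branches" "z \<in> ray (sgn z)"
      using \<open>z \<in> triod\<close> that by (auto simp: branches_eq ray_iff)
    then have "h z \<in> ray (sgn z)"
      using br that sP by blast
    then show "sgn (h z) = sgn z" "h z \<in> triod - {0}"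
      using \<open>sgn z \<in> dirs\<close> by (auto simp: ray_iff)
  qed
  have PS: "P \<subseteq> star P"
    using PP by (auto simp: star_def)
  have sgP: "sgn (h x) = sgn x" "h x \<in> triod - {0}" if "x \<in> P" for x
    using sg[of x] that PS PP by blast+
  obtain x y where xy: "x \<in> P" "y \<in> P" "sgn x \<noteq> sgn y"
    using P by (auto simp: spread_def)
  then have "sgn (h x) \<noteq> sgn (h y)"
    using sgP by auto
  then have "spread Q"
    using xy hPQ Q0 unfolding spread_def by blast
  then have sQ: "triod_hull Q = star Q" by (rule triod_hull_eq_star)
  have hom': "homeomorphism (star P) (star Q) h k" using hom sP sQ by simp
  have inj: "inj_on h (star P)"
    using hom' by (metis homeomorphism_def inj_on_inverseI)
  \<comment> \<open>The preimage of 0 cannot lie on a branch, because branches are mapped into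
    branches.\<close>
  have h0: "h 0 = 0"
  proof -
    have "0 \<in> star Q" by (simp add: star_def)
    then obtain w where w: "w \<in> star P" "h w = 0"
      using hom' by (metis homeomorphism_def imageE)
    then show ?thesis using sg(2)[of w] by auto
  qed
  \<comment> \<open>Otherwise, by the intermediate value theorem, \<open>h\<close> takes the value
    \<open>h y\<close> on the segment from 0 to \<open>x\<close>. The point \<open>y\<close> lies
    beyond \<open>x\<close>, so this contradicts injectivity.\<close>
  have ord: "norm (h x) < norm (h y)" if xy: "x \<in> P" "y \<in> P" "sgn x = sgn y" "norm x < norm y" for x y
  proof (rule ccontr)
    assume "\<not> norm (h x) < norm (h y)"
    then have le: "norm (h y) \<le> norm (h x)" by simp
    define e where "e = sgn x"
    have e: "e \<in> dirs" and x1: "norm x \<le> 1"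
      using xy PP by (auto simp: e_def intro: sgn_in_dirs triod_norm_le)
    define p where "p = (\<lambda>t::real. ret e (h (of_real t * e)))"
    have seg: "of_real t * e \<in> star P" if "0 \<le> t" "t \<le> norm x" for t
      using that xy e x1 by (cases "t = 0")
        (auto simp: star_def e_def sgn_of_real_mult_dirs norm_of_real_mult_dirs intro!: of_real_mult_dirs_in_triod)
    have "continuous_on (star P) h"
      using hom' by (simp add: homeomorphism_def)
    moreover have "continuous_on {0..norm x} (\<lambda>t. of_real t * e)"
      by (intro continuous_intros)
    ultimately have "continuous_on {0..norm x} (\<lambda>t. h (of_real t * e))"
      by (rule continuous_on_compose2) (use seg in auto)
    then have "continuous_on {0..norm x} p"
      unfolding p_def by (rule continuous_on_ret)
    moreover have "p 0 \<le> norm (h y)" by (simp add: p_def h0)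
    moreover have "p (norm x) = norm (h x)"
      using sgP[OF xy(1)] e norm_mult_sgn[of x] by (auto simp: p_def e_def ret_eq)
    ultimately obtain t where t: "0 \<le> t" "t \<le> norm x" "p t = norm (h y)"
      using IVT'[of p 0 "norm (h y)" "norm x"] le by auto
    have hy: "h y \<noteq> 0" "sgn (h y) = e"
      using sgP[OF xy(2)] xy by (auto simp: e_def)
    have "t \<noteq> 0"
      using t hy h0 by (auto simp: p_def)
    then have "sgn (of_real t * e) = e" "of_real t * e \<noteq> 0"
      using t e by (auto simp: sgn_of_real_mult_dirs)
    then have "sgn (h (of_real t * e)) = e" "h (of_real t * e) \<in> triod"
      using sg[OF seg[OF t(1,2)]] by auto
    then have "norm (h (of_real t * e)) = norm (h y)"
      using t(3) e by (simp add: p_def ret_eq)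
    then have "h (of_real t * e) = h y"
      using \<open>sgn (h (of_real t * e)) = e\<close> hy by (metis complex_eqI_sgn_norm)
    then have "of_real t * e = y"
      using inj seg[OF t(1,2)] xy PS by (auto dest: inj_onD)
    then show False
      using t xy e by (auto simp: norm_of_real_mult_dirs)
  qed
  have "bij_betw h P Q"
    using inj PS hPQ by (auto simp: bij_betw_def intro: inj_on_subset)
  then show ?thesis
    unfolding cycle_iso_def using conj ord sgP by (intro exI[of _ h]) blast
qed

text \<open>Piecewise linear interpolation. The nodes are added in increasing order, so each new one
  only changes \<open>H\<close> beyond the previous node.\<close>

lemma strict_mono_interpolation:
  fixes th :: "real \<Rightarrow> real"
  assumes "finite X" "\<And>x. x \<in> X \<Longrightarrow> 0 < x \<and> 0 < th x"
    "\<And>x y. x \<in> X \<Longrightarrow> y \<in> X \<Longrightarrow> x < y \<Longrightarrow> th x < th y"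
  shows "\<exists>H. continuous_on {0..} H \<and> strict_mono_on {0..} H \<and> H 0 = 0 \<and> (\<forall>x\<in>X. H x = th x)"
  using assms
proof (induction X rule: finite_linorder_max_induct)
  case empty
  show ?case by (intro exI[of _ "\<lambda>x. x"]) (auto simp: strict_mono_on_def)
next
  case (insert m X)
  then obtain H where H: "continuous_on {0..} H" "strict_mono_on {0..} H" "H 0 = 0"
    "\<forall>x\<in>X. H x = th x"
    by auto
  define m0 where "m0 = Max (insert 0 X)"
  have m0: "0 \<le> m0" "m0 < m" and m0X: "\<And>x. x \<in> X \<Longrightarrow> x \<le> m0"
    using insert by (auto simp: m0_def)
  have "m0 \<in> insert 0 X"
    unfolding m0_def using insert(1) by (intro Max_in) auto
  then have "H m0 < th m"
    using H insert.prems insert(2) by auto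
  define s where "s = (th m - H m0) / (m - m0)"
  have s: "s > 0" using m0 \<open>H m0 < th m\<close> by (simp add: s_def)
  define G where "G = (\<lambda>x. if x \<le> m0 then H x else H m0 + s * (x - m0))"
  have "continuous_on ({0..m0} \<union> {m0..}) G"
    unfolding G_def
  proof (intro continuous_on_If)
    show "continuous_on {0..m0} H" using H(1) by (rule continuous_on_subset) auto
  qed (auto intro!: continuous_intros)
  moreover have "{0..m0} \<union> {m0..} = {0..}" using m0 by auto
  moreover have "strict_mono_on {0..} G"
  proof (rule strict_mono_onI)
    fix x y :: real assume xy: "x \<in> {0..}" "y \<in> {0..}" "x < y"
    have lt: "H x < H y" if "x \<in> {0..}" "y \<in> {0..}" "x < y" for x y
      using H(2) that by (auto simp: strict_mono_on_def)
    have "H x \<le> H m0" if "x \<le> m0"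
      using lt[of x m0] that xy m0 by fastforce
    moreover have "0 < s * (y - m0)" if "y > m0" using that s by simp
    moreover have "s * (x - m0) < s * (y - m0)" using s xy by simp
    ultimately show "G x < G y"
      unfolding G_def using lt[OF xy] xy(3) by (smt (verit))
  qed
  moreover have "G 0 = 0" using m0 H by (simp add: G_def)
  moreover have "\<forall>x\<in>insert m X. G x = th x"
    using m0 m0X H by (auto simp: G_def s_def)
  ultimately show ?case by metis
qed

lemma spread_cycle_iso:
  assumes "spread P" "cycle_iso h f P g Q" "Q \<subseteq> triod - {0}"
  shows "spread Q"
proof -
  obtain x y where xy: "x \<in> P" "y \<in> P" "sgn x \<noteq> sgn y"
    using assms(1) by (auto simp: spread_def)
  then have "h x \<in> Q" "h y \<in> Q" "sgn (h x) \<noteq> sgn (h y)"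
    using assms(2) by (auto simp: cycle_iso_def bij_betw_def)
  then show ?thesis
    using assms(3) unfolding spread_def by blast
qed

text \<open>The bijection of the cycles is interpolated radially on each branch; compactness of the
  star makes the resulting continuous bijection a homeomorphism.\<close>

lemma cycle_equivI_iso:
  assumes cyc: "(f, P) \<in> cycles" "(g, Q) \<in> cycles" and fin: "finite P" and P: "spread P"
    and Q0: "Q \<subseteq> triod - {0}" and iso: "cycle_iso th f P g Q"
  shows "((f, P), (g, Q)) \<in> cycle_equiv"
proof -
  have P0: "P \<subseteq> triod - {0}" using P by (simp add: spread_def)
  have Q: "spread Q" using spread_cycle_iso[OF P iso Q0] .
  have thPQ: "th ` P = Q" and sg: "\<And>x. x \<in> P \<Longrightarrow> sgn (th x) = sgn x"
    and conj: "\<And>x. x \<in> P \<Longrightarrow> th (f x) = g (th x)"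
    and ord: "\<And>x y. x \<in> P \<Longrightarrow> y \<in> P \<Longrightarrow> sgn x = sgn y \<Longrightarrow> norm x < norm y \<Longrightarrow> norm (th x) < norm (th y)"
    using iso by (auto simp: cycle_iso_def bij_betw_def)
  have "\<exists>H. continuous_on {0..} H \<and> strict_mono_on {0..} H \<and> H 0 = 0 \<and>
      (\<forall>x\<in>P. sgn x = e \<longrightarrow> H (norm x) = norm (th x))" for e
  proof -
    define X where "X = norm ` {x \<in> P. sgn x = e}"
    define t where "t = (\<lambda>r. norm (th (of_real r * e)))"
    have t: "t (norm x) = norm (th x)" if "x \<in> P" "sgn x = e" for x
      using that norm_mult_sgn[of x] by (simp add: t_def)
    have "\<exists>H. continuous_on {0..} H \<and> strict_mono_on {0..} H \<and> H 0 = 0 \<and> (\<forall>x\<in>X. H x = t x)"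
    proof (rule strict_mono_interpolation)
      show "finite X" using fin by (simp add: X_def)
    next
      fix x assume "x \<in> X"
      then show "0 < x \<and> 0 < t x" using t P0 Q0 thPQ by (auto simp: X_def)
    next
      fix x y assume "x \<in> X" "y \<in> X" "x < y"
      then show "t x < t y" using t ord by (auto simp: X_def)
    qed
    then show ?thesis using t by (auto simp: X_def)
  qed
  then obtain H where H: "\<And>e. continuous_on {0..} (H e)" "\<And>e. strict_mono_on {0..} (H e)"
    "\<And>e. H e 0 = 0" "\<And>x. x \<in> P \<Longrightarrow> H (sgn x) (norm x) = norm (th x)"
    by metis
  \<comment> \<open>All three radial functions in one formula: \<open>ret e\<close> vanishes off its
    own branch and \<open>H e 0 = 0\<close>, so at most one summand is nonzero, and continuity at 0
    requires no gluing.\<close>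
  define F where "F = (\<lambda>z. \<Sum>e\<in>dirs. of_real (H e (ret e z)) * e)"
  have F0: "F 0 = 0" by (simp add: F_def H(3))
  have F: "F z = of_real (H (sgn z) (norm z)) * sgn z" if "z \<in> triod" "z \<noteq> 0" for z
  proof -
    have "F z = (\<Sum>e\<in>dirs. if e = sgn z then of_real (H (sgn z) (norm z)) * sgn z else 0)"
      unfolding F_def using that by (intro sum.cong) (auto simp: ret_eq H(3))
    then show ?thesis using that by (simp add: sgn_in_dirs)
  qed
  have Hlt: "H e r < H e s" if "0 \<le> r" "r < s" for e r s
    using H(2)[of e] that by (auto simp: strict_mono_on_def)
  have Hle: "H e r \<le> H e s" if "0 \<le> r" "r \<le> s" for e r s
    using Hlt[of r s e] that by (cases "r = s") auto
  have Hpos: "H e r > 0" if "0 < r" for e r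
    using Hlt[of 0 r e] that H(3) by simp
  have Fsgn: "sgn (F z) = sgn z" "norm (F z) = H (sgn z) (norm z)" "F z \<noteq> 0" if "z \<in> triod" "z \<noteq> 0" for z
    using F[OF that] Hpos[of "norm z" "sgn z"] that
    by (auto simp: sgn_of_real_mult_dirs norm_of_real_mult_dirs sgn_in_dirs)
  have Fth: "F x = th x" if "x \<in> P" for x
  proof (rule complex_eqI_sgn_norm)
    have x: "x \<in> triod" "x \<noteq> 0"
      using that P0 by auto
    show "sgn (F x) = sgn (th x)"
      by (simp only: Fsgn(1)[OF x] sg[OF that])
    show "norm (F x) = norm (th x)"
      by (simp only: Fsgn(2)[OF x] H(4)[OF that])
  qed
  have St: "star P \<subseteq> triod" by (auto simp: star_def)
  have contF: "continuous_on (star P) F"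
    unfolding F_def
    by (intro continuous_intros continuous_on_compose2[OF H(1)]) auto
  have injF: "inj_on F (star P)"
  proof (rule inj_onI)
    fix z w assume zw: "z \<in> star P" "w \<in> star P" "F z = F w"
    show "z = w"
    proof (cases "z = 0 \<or> w = 0")
      case True
      then show ?thesis using zw F0 Fsgn(3) St by (metis subsetD)
    next
      case False
      then have "sgn z = sgn w" "H (sgn z) (norm z) = H (sgn z) (norm w)"
        using Fsgn zw St by (metis subsetD)+
      then show ?thesis
        using Hlt[of "norm z" "norm w"] Hlt[of "norm w" "norm z"]
        by (metis complex_eqI_sgn_norm linorder_neqE_linordered_idom norm_ge_zero order_less_irrefl)
    qed
  qed
  have imF: "F ` star P = star Q"
  proof
    show "F ` star P \<subseteq> star Q"
    proof
      fix v assume "v \<in> F ` star P"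
      then obtain z where z: "z \<in> star P" "v = F z" by auto
      show "v \<in> star Q"
      proof (cases "z = 0")
        case False
        then obtain x where x: "x \<in> P" "sgn x = sgn z" "norm z \<le> norm x" and zt: "z \<in> triod"
          using z by (auto simp: star_def)
        have "norm v \<le> norm (th x)"
          using Fsgn(2)[OF zt False] Hle[of "norm z" "norm x" "sgn z"] x H(4)[of x] z by auto
        moreover have "th x \<in> Q" "sgn (th x) = sgn v"
          using x thPQ sg Fsgn(1)[OF zt False] z by auto
        moreover have "norm (th x) \<le> 1"
          using \<open>th x \<in> Q\<close> Q0 triod_norm_le by auto
        moreover have "sgn v \<in> dirs"
          using Fsgn(1)[OF zt False] z zt False sgn_in_dirs by auto
        ultimately show ?thesis
          by (auto simp: star_def triod_iff)
      qed (use z F0 in \<open>simp add: star_def\<close>)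
    qed
    show "star Q \<subseteq> F ` star P"
    proof
      fix w assume w: "w \<in> star Q"
      show "w \<in> F ` star P"
      proof (cases "w = 0")
        case True
        then show ?thesis using F0 by (intro image_eqI[of _ _ 0]) (auto simp: star_def)
      next
        case False
        then obtain y where y: "y \<in> Q" "sgn y = sgn w" "norm w \<le> norm y" and wt: "w \<in> triod"
          using w by (auto simp: star_def)
        obtain x where x: "x \<in> P" "y = th x" using y thPQ by auto
        define e where "e = sgn w"
        have e: "e \<in> dirs" "sgn x = e"
          using wt False y x sg by (auto simp: e_def sgn_in_dirs)
        have "continuous_on {0..norm x} (H e)" using H(1) by (rule continuous_on_subset) auto
        then obtain t where t: "0 \<le> t" "t \<le> norm x" "H e t = norm w"
          using IVT'[of "H e" 0 "norm w" "norm x"] H(3)[of e] H(4)[OF x(1)] e x y by auto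
        have "t > 0" using t False H(3)[of e] by (cases "t = 0") auto
        define z where "z = of_real t * e"
        have z: "sgn z = e" "norm z = t" "z \<noteq> 0"
          using \<open>t > 0\<close> e by (auto simp: z_def sgn_of_real_mult_dirs norm_of_real_mult_dirs)
        have "norm x \<le> 1" using x P0 triod_norm_le by auto
        then have "z \<in> triod" using z e t by (auto simp: triod_iff)
        then have "z \<in> star P" using x t z e by (auto simp: star_def)
        moreover have "F z = w"
        proof (rule complex_eqI_sgn_norm)
          show "sgn (F z) = sgn w"
            by (simp only: Fsgn(1)[OF \<open>z \<in> triod\<close> z(3)] z(1) e_def)
          show "norm (F z) = norm w"
            by (simp only: Fsgn(2)[OF \<open>z \<in> triod\<close> z(3)] z(1,2) t(3))
        qed
        ultimately show ?thesis by blast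
      qed
    qed
  qed
  have "compact (star P)"
  proof -
    have "star P = insert 0 (\<Union>x\<in>P. closed_segment 0 x)"
    proof
      show "star P \<subseteq> insert 0 (\<Union>x\<in>P. closed_segment 0 x)"
      proof
        fix z assume z: "z \<in> star P"
        show "z \<in> insert 0 (\<Union>x\<in>P. closed_segment 0 x)"
        proof (cases "z = 0")
          case False
          then obtain x where x: "x \<in> P" "sgn x = sgn z" "norm z \<le> norm x"
            using z by (auto simp: star_def)
          have "norm z *\<^sub>R sgn z = z"
            using norm_mult_sgn[of z] by (simp only: scaleR_conv_of_real)
          then have "z = norm z *\<^sub>R sgn x"
            using x(2) by simp
          then have "z = (norm z / norm x) *\<^sub>R x"
            by (simp only: sgn_div_norm scaleR_scaleR divide_inverse)
          then have "z \<in> closed_segment 0 x"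
            unfolding closed_segment_def using x(3) by (intro CollectI exI[of _ "norm z / norm x"]) (auto simp: divide_le_eq_1)
          then show ?thesis using x by blast
        qed simp
      qed
      show "insert 0 (\<Union>x\<in>P. closed_segment 0 x) \<subseteq> star P"
      proof -
        have "closed_segment 0 x \<subseteq> star P" if "x \<in> P" for x
        proof
          fix w assume "w \<in> closed_segment 0 x"
          then obtain t where t: "0 \<le> t" "t \<le> 1" "w = t *\<^sub>R x"
            by (auto simp: closed_segment_def)
          show "w \<in> star P"
          proof (cases "t = 0")
            case False
            then have "sgn w = sgn x" "norm w \<le> norm x"
              using t by (auto simp: sgn_scaleR mult_left_le_one_le)
            then show ?thesis
              using \<open>x \<in> P\<close> P0 by (auto simp: star_def triod_iff)
          qed (use t in \<open>simp add: star_def\<close>)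
        qed
        then show ?thesis by (auto simp: star_def)
      qed
    qed
    then show ?thesis using fin by (auto intro!: compact_insert compact_UN)
  qed
  then obtain k where k: "homeomorphism (star P) (star Q) F k"
    using homeomorphism_compact[OF _ contF imF injF] by blast
  have br: "F ` (star P \<inter> c) \<subseteq> c" if c: "c \<in> branches" for c
  proof
    fix v assume "v \<in> F ` (star P \<inter> c)"
    then obtain z where z: "z \<in> star P" "z \<in> c" "v = F z" by auto
    from c obtain e where e: "e \<in> dirs" "c = ray e" by (auto simp: branches_eq)
    then have "z \<in> triod" "z \<noteq> 0" "sgn z = e" using z by (auto simp: ray_iff)
    moreover have "F z \<in> triod" using imF z(1) by (auto simp: star_def)
    ultimately show "v \<in> c" using z e Fsgn by (auto simp: ray_iff)
  qed
  have FP: "F ` P = Q"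
    using Fth thPQ by force
  have fP: "f x \<in> P" if "x \<in> P" for x
  proof -
    obtain x0 where "P = range (\<lambda>i. (f ^^ i) x0)"
      using cyc(1) by (auto simp: cycles_def periodic_orbit_def)
    then show ?thesis using that by (auto simp: image_iff intro: exI[of _ "Suc _"])
  qed
  have "\<forall>x\<in>P. F (f x) = g (F x)"
    using conj fP Fth by auto
  then have "\<exists>h k. homeomorphism (triod_hull P) (triod_hull Q) h k \<and> h ` P = Q \<and>
      (\<forall>x\<in>P. h (f x) = g (h x)) \<and> (\<forall>c\<in>branches. h ` (triod_hull P \<inter> c) \<subseteq> c)"
    unfolding triod_hull_eq_star[OF P] triod_hull_eq_star[OF Q] using k FP br by blast
  then show ?thesis
    unfolding cycle_equiv_def using cyc by simp
qed


section \<open>Orbit sums\<close>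

lemma triod_maps_zero: "f \<in> triod_maps \<Longrightarrow> f 0 = 0"
  by (auto simp: triod_maps_def)

lemma triod_maps_closed: "f \<in> triod_maps \<Longrightarrow> z \<in> triod \<Longrightarrow> f z \<in> triod"
  by (auto simp: triod_maps_def)

lemma funpow_zero: "f 0 = 0 \<Longrightarrow> (f ^^ i) 0 = (0 :: complex)" for f :: "complex \<Rightarrow> complex"
  by (induction i) auto

lemma funpow_mult_fixed: "(f ^^ n) x = x \<Longrightarrow> (f ^^ (n * k)) x = x"
  by (induction k) (auto simp: funpow_add)

lemma funpow_mod_fixed: "(f ^^ n) x = x \<Longrightarrow> (f ^^ (k mod n)) x = (f ^^ k) x"
  by (rule funpow_mod_eq)

locale cyc =
  fixes f :: "complex \<Rightarrow> complex" and P :: "complex set"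
  assumes cycle: "(f, P) \<in> cycles"
begin

lemma maps: "f \<in> triod_maps"
  using cycle by (simp add: cycles_def)

lemma f_zero [simp]: "f 0 = 0"
  using maps by (rule triod_maps_zero)

lemma least_period:
  obtains x n where "n > 0" "(f ^^ n) x = x" "P = (\<lambda>i. (f ^^ i) x) ` {..<n}" "inj_on (\<lambda>i. (f ^^ i) x) {..<n}"
    "x \<in> triod - {0}"
proof -
  obtain x n0 where x: "x \<in> triod" "n0 > 0" "(f ^^ n0) x = x" "P = range (\<lambda>i. (f ^^ i) x)" "P \<noteq> {0}"
    using cycle by (auto simp: cycles_def periodic_orbit_def)
  define n where "n = (LEAST n. n > 0 \<and> (f ^^ n) x = x)"
  have n: "n > 0 \<and> (f ^^ n) x = x"
    unfolding n_def by (rule LeastI[of _ n0]) (use x in auto)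
  have least: "n \<le> m" if "m > 0" "(f ^^ m) x = x" for m
    unfolding n_def by (rule Least_le) (use that in auto)
  have "P = (\<lambda>i. (f ^^ i) x) ` {..<n}"
  proof
    show "P \<subseteq> (\<lambda>i. (f ^^ i) x) ` {..<n}"
    proof
      fix y assume "y \<in> P"
      then obtain i where "y = (f ^^ i) x" using x by auto
      then have "y = (f ^^ (i mod n)) x" using n funpow_mod_fixed[of n f x i] by simp
      then show "y \<in> (\<lambda>i. (f ^^ i) x) ` {..<n}" using n by (intro image_eqI[of _ _ "i mod n"]) auto
    qed
  qed (use x in auto)
  moreover have "inj_on (\<lambda>i. (f ^^ i) x) {..<n}"
  proof (rule linorder_inj_onI)
    fix i j assume ij: "i < j" "i \<in> {..<n}" "j \<in> {..<n}"
    show "(f ^^ i) x \<noteq> (f ^^ j) x"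
    proof
      assume "(f ^^ i) x = (f ^^ j) x"
      then have "(f ^^ (n - j)) ((f ^^ i) x) = (f ^^ (n - j)) ((f ^^ j) x)" by simp
      then have "(f ^^ (n - j + i)) x = (f ^^ (n - j + j)) x"
        by (simp only: funpow_add o_apply)
      then have "(f ^^ (n - j + i)) x = x" using n ij by simp
      then show False using least[of "n - j + i"] ij by auto
    qed
  qed auto
  moreover have "x \<noteq> 0"
    using x funpow_zero[of f] by auto
  ultimately show ?thesis using that n x(1) by blast
qed

lemma finite_P [simp]: "finite P"
  using least_period by (metis finite_imageI finite_lessThan)

lemma card_P_pos: "card P > 0"
proof -
  obtain x n where x: "n > 0" "P = (\<lambda>i. (f ^^ i) x) ` {..<n}"
    using least_period .
  then have "P \<noteq> {}" by auto
  then show ?thesis by (simp add: card_gt_0_iff)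
qed

lemma P_nonempty: "P \<noteq> {}"
  using card_P_pos by auto

lemma f_in_P: "x \<in> P \<Longrightarrow> f x \<in> P"
proof -
  assume "x \<in> P"
  obtain x0 where "P = range (\<lambda>i. (f ^^ i) x0)"
    using cycle by (auto simp: cycles_def periodic_orbit_def)
  then show ?thesis using \<open>x \<in> P\<close> by (auto simp: image_iff intro: exI[of _ "Suc _"])
qed

lemma funpow_in_P: "x \<in> P \<Longrightarrow> (f ^^ k) x \<in> P"
  by (induction k) (auto intro: f_in_P)

lemma funpow_card: "x \<in> P \<Longrightarrow> (f ^^ card P) x = x"
proof -
  assume x: "x \<in> P"
  obtain x0 n where n: "(f ^^ n) x0 = x0" "P = (\<lambda>i. (f ^^ i) x0) ` {..<n}" "inj_on (\<lambda>i. (f ^^ i) x0) {..<n}"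
    using least_period .
  then have c: "card P = n" by (simp add: card_image)
  obtain i where "x = (f ^^ i) x0" using x n by auto
  then have "(f ^^ n) x = (f ^^ i) ((f ^^ n) x0)"
    by (metis add.commute comp_apply funpow_add)
  then show ?thesis using n c \<open>x = (f ^^ i) x0\<close> by simp
qed

text \<open>An orbit that meets the fixed point 0 stays there and cannot return to a nonzero
  starting point.\<close>

lemma in_triod: "P \<subseteq> triod - {0}"
proof
  fix y assume y: "y \<in> P"
  obtain x0 n where n: "n > 0" "P = (\<lambda>i. (f ^^ i) x0) ` {..<n}" "x0 \<in> triod - {0}"
    using least_period .
  obtain i where i: "i < n" "y = (f ^^ i) x0" using y n by auto
  have "(f ^^ i) x0 \<in> triod" for i
    by (induction i) (use n maps in \<open>auto intro: triod_maps_closed\<close>)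
  moreover have "y \<noteq> 0"
  proof
    assume "y = 0"
    have "x0 \<in> P" using n by (auto intro: image_eqI[of _ _ 0])
    then have "(f ^^ (card P * Suc i)) x0 = x0"
      by (intro funpow_mult_fixed funpow_card)
    moreover have "card P * Suc i = (card P * Suc i - i) + i"
      using card_P_pos by (cases "card P") auto
    ultimately have "(f ^^ (card P * Suc i - i)) ((f ^^ i) x0) = x0"
      by (metis comp_apply funpow_add)
    then have "x0 = 0" using i \<open>y = 0\<close> funpow_zero[of f] by simp
    then show False using n by simp
  qed
  ultimately show "y \<in> triod - {0}" using i by simp
qed

lemma bij_betw_orbit:
  assumes "x \<in> P"
  shows "bij_betw (\<lambda>i. (f ^^ i) x) {..<card P} P"
proof -
  obtain x0 n where n: "(f ^^ n) x0 = x0" "P = (\<lambda>i. (f ^^ i) x0) ` {..<n}" "inj_on (\<lambda>i. (f ^^ i) x0) {..<n}"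
    using least_period .
  then have c: "card P = n" by (simp add: card_image)
  obtain j where j: "x = (f ^^ j) x0" "j < n" using assms n by auto
  have "P \<subseteq> (\<lambda>i. (f ^^ i) x) ` {..<card P}"
  proof
    fix y assume "y \<in> P"
    then obtain i where i: "y = (f ^^ i) x0" "i < n" using n by auto
    have "(f ^^ (n - j)) x = (f ^^ (n - j + j)) x0"
      unfolding j(1) by (simp only: funpow_add o_apply)
    then have x0: "x0 = (f ^^ (n - j)) x"
      using j(2) n(1) by simp
    have "y = (f ^^ (i + (n - j))) x"
      by (simp only: funpow_add o_apply x0[symmetric] i(1))
    also have "\<dots> = (f ^^ ((i + (n - j)) mod n)) x"
      using funpow_card[OF assms] c by (intro funpow_mod_fixed[symmetric]) simp
    finally show "y \<in> (\<lambda>i. (f ^^ i) x) ` {..<card P}"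
      using c j by (intro image_eqI[of _ _ "(i + (n - j)) mod n"]) auto
  qed
  moreover have "(\<lambda>i. (f ^^ i) x) ` {..<card P} \<subseteq> P"
    using funpow_in_P[OF assms] by auto
  ultimately have im: "(\<lambda>i. (f ^^ i) x) ` {..<card P} = P" by auto
  then have "inj_on (\<lambda>i. (f ^^ i) x) {..<card P}"
    by (intro eq_card_imp_inj_on) auto
  with im show ?thesis by (simp add: bij_betw_def)
qed

lemma orbit_reaches:
  assumes "x \<in> P" "y \<in> P"
  obtains k where "k < card P" "y = (f ^^ k) x"
  using bij_betw_orbit[OF assms(1)] assms(2) by (auto simp: bij_betw_def image_iff)

lemma card_dvd_period:
  assumes "x \<in> P" "(f ^^ k) x = x"
  shows "card P dvd k"
proof -
  have "(f ^^ (k mod card P)) x = (f ^^ 0) x"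
    using funpow_mod_fixed[OF funpow_card[OF assms(1)]] assms(2) by simp
  then have "k mod card P = 0"
    using inj_onD[OF bij_betw_imp_inj_on[OF bij_betw_orbit[OF assms(1)]], of "k mod card P" 0] card_P_pos
    by simp
  then show ?thesis by auto
qed

lemma sum_orbit: "x \<in> P \<Longrightarrow> (\<Sum>i<card P. D ((f ^^ i) x)) = (\<Sum>y\<in>P. D y)"
  using bij_betw_orbit by (rule sum.reindex_bij_betw)

text \<open>A cycle that tracks a walk of length \<open>N\<close> may have a proper divisor of
  \<open>N\<close> as its period. Its averages can still be computed along the walk.\<close>

lemma sum_period:
  fixes D :: "complex \<Rightarrow> real"
  assumes "x \<in> P" "(f ^^ N) x = x"
  shows "real (card P) * (\<Sum>i<N. D ((f ^^ i) x)) = real N * (\<Sum>y\<in>P. D y)"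
proof -
  obtain t where t: "N = t * card P"
    using card_dvd_period[OF assms] by (metis dvdE mult.commute)
  have "(\<Sum>i<N. D ((f ^^ i) x)) = (\<Sum>m<t. \<Sum>i\<in>{m * card P..<m * card P + card P}. D ((f ^^ i) x))"
    unfolding t by (rule sum.nat_group[symmetric])
  also have "\<dots> = (\<Sum>m<t. \<Sum>y\<in>P. D y)"
  proof (intro sum.cong refl)
    fix m
    have "(\<Sum>i\<in>{m * card P..<m * card P + card P}. D ((f ^^ i) x)) =
        (\<Sum>i\<in>{0..<card P}. D ((f ^^ (i + m * card P)) x))"
      using sum.shift_bounds_nat_ivl[of "\<lambda>i. D ((f ^^ i) x)" 0 "m * card P" "card P"]
      by (simp add: add.commute)
    also have "\<dots> = (\<Sum>i<card P. D ((f ^^ i) x))"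
      using funpow_mult_fixed[OF funpow_card[OF assms(1)], of m]
      by (intro sum.cong) (auto simp: funpow_add mult.commute)
    finally show "(\<Sum>i\<in>{m * card P..<m * card P + card P}. D ((f ^^ i) x)) = (\<Sum>y\<in>P. D y)"
      using sum_orbit[OF assms(1)] by simp
  qed
  finally show ?thesis by (simp add: t)
qed

text \<open>Sum \<open>W\<close> along the orbit from a base point; the vanishing total makes this
  consistent where the orbit closes up.\<close>

lemma potential_exists:
  fixes W :: "complex \<Rightarrow> real"
  assumes "(\<Sum>y\<in>P. W y) = 0"
  shows "\<exists>L. \<forall>y\<in>P. L (f y) = L y + W y"
proof -
  obtain x where x: "x \<in> P" using P_nonempty by auto
  define k where "k = the_inv_into {..<card P} (\<lambda>i. (f ^^ i) x)"
  define L where "L = (\<lambda>y. \<Sum>i<k y. W ((f ^^ i) x))"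
  have bij: "bij_betw (\<lambda>i. (f ^^ i) x) {..<card P} P" using bij_betw_orbit[OF x] .
  have k: "k ((f ^^ i) x) = i" if "i < card P" for i
    using bij that unfolding k_def bij_betw_def by (metis lessThan_iff the_inv_into_f_f)
  have L: "L ((f ^^ i) x) = (\<Sum>j<i. W ((f ^^ j) x))" if "i \<le> card P" for i
  proof (cases "i = card P")
    case True
    then show ?thesis
      using k[of 0] card_P_pos funpow_card[OF x] sum_orbit[OF x, of W] assms by (simp add: L_def)
  qed (use k that in \<open>simp add: L_def\<close>)
  have "L (f y) = L y + W y" if y: "y \<in> P" for y
  proof -
    obtain i where i: "i < card P" "y = (f ^^ i) x" by (rule orbit_reaches[OF x y])
    then show ?thesis using L[of i] L[of "Suc i"] by simp
  qed
  then show ?thesis by blast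
qed

end


section \<open>Periodic orbits tracking a walk\<close>

lemma first_hit:
  fixes g :: "real \<Rightarrow> real"
  assumes "a \<le> b" "continuous_on {a..b} g" "g a \<le> s" "s \<le> g b"
  shows "Inf {r \<in> {a..b}. g r = s} \<in> {a..b}" "g (Inf {r \<in> {a..b}. g r = s}) = s"
proof -
  let ?S = "{r \<in> {a..b}. g r = s}"
  have "?S \<noteq> {}"
    using IVT'[of g a s b] assms by auto
  moreover have "closed ?S"
    using continuous_closed_preimage_constant[OF assms(2) closed_atLeastAtMost] by simp
  moreover have "bdd_below ?S"
    by (rule bdd_belowI[of _ a]) auto
  ultimately have "Inf ?S \<in> ?S"
    by (intro closed_contains_Inf)
  then show "Inf ?S \<in> {a..b}" "g (Inf ?S) = s"
    by auto
qed

lemma first_hit_le: "r \<in> {a..b} \<Longrightarrow> g r = s \<Longrightarrow> Inf {r \<in> {a..b}. g r = s} \<le> (r :: real)"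
  by (rule cInf_lower) (auto intro: bdd_belowI[of _ a])

text \<open>Before reaching the higher value \<open>s'\<close> for the first time, \<open>g\<close>
  has to pass through \<open>s\<close>.\<close>

lemma first_hit_strict_mono:
  fixes g :: "real \<Rightarrow> real"
  assumes "a \<le> b" "continuous_on {a..b} g" "g a \<le> s" "s < s'" "s' \<le> g b"
  shows "Inf {r \<in> {a..b}. g r = s} < Inf {r \<in> {a..b}. g r = s'}"
proof -
  define h' where "h' = Inf {r \<in> {a..b}. g r = s'}"
  have h': "h' \<in> {a..b}" "g h' = s'"
    unfolding h'_def using first_hit[of a b g s'] assms by auto
  have "continuous_on {a..h'} g"
    using assms(2) h' by (auto intro: continuous_on_subset)
  then obtain r where r: "a \<le> r" "r \<le> h'" "g r = s"
    using IVT'[of g a s h'] h' assms by auto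
  then have "Inf {r \<in> {a..b}. g r = s} \<le> r"
    using h' by (intro first_hit_le) auto
  moreover have "r \<noteq> h'" using r h' assms(4) by auto
  ultimately show ?thesis using r unfolding h'_def by linarith
qed

definition below :: "complex \<Rightarrow> complex \<Rightarrow> bool" where
  "below x y \<longleftrightarrow> sgn x = sgn y \<and> norm x \<le> norm y"

lemma below_refl [simp]: "below x x"
  by (simp add: below_def)

lemma below_trans: "below x y \<Longrightarrow> below y z \<Longrightarrow> below x z"
  by (simp add: below_def)

lemma periodic_mult: "(\<And>k. v (k + N) = v k) \<Longrightarrow> v (k + N * m) = v (k :: nat)"
proof (induction m)
  case (Suc m)
  have "v (k + N * Suc m) = v (k + N * m + N)" by (simp add: ac_simps)
  then show ?case using Suc by simp
qed simp

context cyc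
begin

definition walk :: "(nat \<Rightarrow> complex) \<Rightarrow> bool" where
  "walk w \<longleftrightarrow> (\<forall>k. w k \<in> P \<and> below (w (Suc k)) (f (w k)))"

text \<open>Minimality ensures that the interval between \<open>v k\<close> and its predecessor in \<open>P\<close> covers the
  corresponding interval at \<open>v (Suc k)\<close> under \<open>f\<close>.\<close>

definition min_walk :: "(nat \<Rightarrow> complex) \<Rightarrow> bool" where
  "min_walk v \<longleftrightarrow> walk v \<and>
     (\<forall>k. \<forall>z\<in>P. sgn z = sgn (v k) \<longrightarrow> below (v (Suc k)) (f z) \<longrightarrow> norm (v k) \<le> norm z)"

text \<open>Among all walks that visit the branches of \<open>w\<close> from time \<open>k\<close>
  on, take the innermost starting point. These choices fit together into a walk because a point
  whose image lies above the next choice is itself a candidate. They depend only on the remaining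
  itinerary, so they inherit its period.\<close>

lemma min_walk_exists:
  assumes w: "walk w" and per: "\<And>k. w (k + N) = w k"
  obtains v where "min_walk v" "\<And>k. sgn (v k) = sgn (w k)" "\<And>k. v (k + N) = v k"
proof -
  define R where "R = (\<lambda>k. {x. \<exists>u. u 0 = x \<and> walk u \<and> (\<forall>m. sgn (u m) = sgn (w (k + m)))})"
  define v where "v = (\<lambda>k. arg_min_on norm (R k))"
  have RP: "R k \<subseteq> {x \<in> P. sgn x = sgn (w k)}" for k
  proof
    fix x assume "x \<in> R k"
    then obtain u where "u 0 = x" "walk u" "sgn (u 0) = sgn (w (k + 0))"
      unfolding R_def by blast
    then show "x \<in> {x \<in> P. sgn x = sgn (w k)}"
      by (auto simp: walk_def)
  qed
  have fin: "finite (R k)" for k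
    using RP[of k] by (rule finite_subset) auto
  have "w k \<in> R k" for k
    unfolding R_def using w by (auto simp: walk_def intro!: exI[of _ "\<lambda>m. w (k + m)"])
  then have ne: "R k \<noteq> {}" for k by blast
  have v: "v k \<in> R k" for k
    unfolding v_def using fin ne by (rule arg_min_if_finite(1))
  have least: "norm (v k) \<le> norm z" if "z \<in> R k" for k z
    unfolding v_def using fin that by (rule arg_min_least[OF _ ne])
  have vP: "v k \<in> P" "sgn (v k) = sgn (w k)" for k
    using v[of k] RP[of k] by auto
  have ext: "z \<in> R k" if z: "z \<in> P" "sgn z = sgn (w k)" and "below (v (Suc k)) (f z)" for k z
  proof -
    obtain u where u: "u 0 = v (Suc k)" "walk u" "\<forall>m. sgn (u m) = sgn (w (Suc k + m))"
      using v[of "Suc k"] unfolding R_def by blast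
    define u' where "u' = case_nat z u"
    have "walk u'"
      unfolding walk_def
    proof
      fix i show "u' i \<in> P \<and> below (u' (Suc i)) (f (u' i))"
        using u z that(3) by (cases i) (auto simp: u'_def walk_def)
    qed
    moreover have "\<forall>m. sgn (u' m) = sgn (w (k + m))"
    proof
      fix m show "sgn (u' m) = sgn (w (k + m))"
        using u z by (cases m) (auto simp: u'_def)
    qed
    moreover have "u' 0 = z" by (simp add: u'_def)
    ultimately show ?thesis unfolding R_def by blast
  qed
  have step: "below (v (Suc k)) (f (v k))" for k
  proof -
    obtain u where u: "u 0 = v k" "walk u" "\<forall>m. sgn (u m) = sgn (w (k + m))"
      using v[of k] unfolding R_def by blast
    have "u (Suc 0) \<in> R (Suc k)"
      unfolding R_def using u(2,3) by (auto simp: walk_def intro!: exI[of _ "\<lambda>m. u (Suc m)"])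
    then have "below (v (Suc k)) (u (Suc 0))"
      using least u(3) vP(2)[of "Suc k"] by (auto simp: below_def)
    moreover have "below (u (Suc 0)) (f (u 0))"
      using u(2) unfolding walk_def by blast
    ultimately show ?thesis using u(1) below_trans by metis
  qed
  have "min_walk v"
    unfolding min_walk_def walk_def using vP step ext least by simp
  moreover have "R (k + N) = R k" for k
    unfolding R_def using per by (metis add.assoc add.commute)
  then have "v (k + N) = v k" for k by (simp add: v_def)
  ultimately show ?thesis using that vP by blast
qed

text \<open>The radius of the point of \<open>P\<close> preceding \<open>v\<close> on its branch, and \<open>0\<close> if there is none.\<close>

definition pr :: "complex \<Rightarrow> real" where
  "pr v = Max (insert 0 (norm ` {x \<in> P. sgn x = sgn v \<and> norm x < norm v}))"

lemma pr_cases: "pr v = 0 \<or> (of_real (pr v) * sgn v \<in> P \<and> pr v < norm v)"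
proof -
  have "pr v \<in> insert 0 (norm ` {x \<in> P. sgn x = sgn v \<and> norm x < norm v})"
    unfolding pr_def by (rule Max_in) auto
  then show ?thesis
  proof
    assume "pr v \<in> norm ` {x \<in> P. sgn x = sgn v \<and> norm x < norm v}"
    then obtain x where "x \<in> P" "sgn x = sgn v" "norm x < norm v" "pr v = norm x" by auto
    then show ?thesis using norm_mult_sgn[of x] by simp
  qed simp
qed

lemma pr_nonneg: "0 \<le> pr v"
  unfolding pr_def by (rule Max_ge) auto

lemma pr_less: "v \<in> P \<Longrightarrow> pr v < norm v"
  using pr_cases[of v] in_triod by auto

lemma le_pr: "x \<in> P \<Longrightarrow> sgn x = sgn v \<Longrightarrow> norm x < norm v \<Longrightarrow> norm x \<le> pr v"
  unfolding pr_def by (rule Max_ge) auto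

lemma pr_eq_0_iff: "pr v = 0 \<longleftrightarrow> (\<forall>x\<in>P. sgn x = sgn v \<longrightarrow> norm v \<le> norm x)"
proof
  assume "pr v = 0"
  then show "\<forall>x\<in>P. sgn x = sgn v \<longrightarrow> norm v \<le> norm x"
    using le_pr[of _ v] in_triod by fastforce
next
  assume "\<forall>x\<in>P. sgn x = sgn v \<longrightarrow> norm v \<le> norm x"
  then have "{x \<in> P. sgn x = sgn v \<and> norm x < norm v} = {}" by auto
  then show "pr v = 0" by (simp only: pr_def) simp
qed

lemma P_dirs: "x \<in> P \<Longrightarrow> sgn x \<in> dirs" "x \<in> P \<Longrightarrow> norm x \<le> 1" "x \<in> P \<Longrightarrow> x \<in> triod" "x \<in> P \<Longrightarrow> x \<noteq> 0"
  using in_triod by (auto intro: sgn_in_dirs triod_norm_le)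

text \<open>The map \<open>f\<close> along the branch of \<open>v\<close> as a real function: images
  off the branch of \<open>f v\<close> collapse to 0, and the intermediate value theorem
  applies.\<close>

definition level :: "complex \<Rightarrow> real \<Rightarrow> real" where
  "level v r = ret (sgn (f v)) (f (of_real r * sgn v))"

lemma level_0 [simp]: "level v 0 = 0"
  by (simp add: level_def)

lemma level_norm: "v \<in> P \<Longrightarrow> level v (norm v) = norm (f v)"
  using P_dirs[OF f_in_P] norm_mult_sgn[of v] by (simp add: level_def ret_eq)

lemma continuous_on_level:
  assumes "v \<in> P"
  shows "continuous_on {pr v..norm v} (level v)"
proof -
  have "continuous_on {pr v..norm v} (\<lambda>r. of_real r * sgn v)"
    by (intro continuous_intros)
  moreover have "continuous_on triod f" using maps by (simp add: triod_maps_def)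
  ultimately have "continuous_on {pr v..norm v} (\<lambda>r. f (of_real r * sgn v))"
    using P_dirs[OF assms] pr_nonneg[of v]
    by (rule_tac continuous_on_compose2[of triod f]) (auto intro!: of_real_mult_dirs_in_triod)
  then show ?thesis unfolding level_def by (rule continuous_on_ret)
qed

text \<open>By minimality of the walk, the point of \<open>P\<close> preceding \<open>v k\<close> is
  not mapped to or above \<open>v (Suc k)\<close>. Its image therefore lies on another branch or no
  farther out than the predecessor of \<open>v (Suc k)\<close>.\<close>

lemma level_pr_le:
  assumes "min_walk v"
  shows "level (v k) (pr (v k)) \<le> pr (v (Suc k))"
proof (cases "pr (v k) = 0")
  case True
  then show ?thesis using pr_nonneg by simp
next
  case False
  define u where "u = of_real (pr (v k)) * sgn (v k)"
  have vP: "v k \<in> P" "v (Suc k) \<in> P" "sgn (v (Suc k)) = sgn (f (v k))"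
    using assms by (auto simp: min_walk_def walk_def below_def)
  have u: "u \<in> P" using pr_cases[of "v k"] False by (simp add: u_def)
  have nu: "norm u = pr (v k)" "sgn u = sgn (v k)"
    using P_dirs(1)[OF vP(1)] pr_nonneg[of "v k"] False
    by (auto simp: u_def norm_of_real_mult_dirs sgn_of_real_mult_dirs)
  have lev: "level (v k) (pr (v k)) = ret (sgn (v (Suc k))) (f u)"
    by (simp add: level_def u_def vP)
  show ?thesis
  proof (cases "sgn (f u) = sgn (v (Suc k))")
    case True
    have "\<not> below (v (Suc k)) (f u)"
      using assms u nu pr_less[OF vP(1)] unfolding min_walk_def by force
    then have "norm (f u) < norm (v (Suc k))"
      using True by (simp add: below_def)
    then have "norm (f u) \<le> pr (v (Suc k))"
      using le_pr True f_in_P[OF u] by simp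
    then show ?thesis
      using lev True P_dirs[OF f_in_P[OF u]] vP by (simp add: ret_eq)
  next
    case f: False
    then show ?thesis
      using lev P_dirs[OF f_in_P[OF u]] P_dirs[OF vP(2)] pr_nonneg by (simp add: ret_eq)
  qed
qed

text \<open>The last clause settles comparisons between visits to the same vertex, where the
  half-open intervals alone give no order.\<close>

definition tracking :: "(nat \<Rightarrow> complex) \<Rightarrow> (nat \<Rightarrow> real) \<Rightarrow> bool" where
  "tracking v r \<longleftrightarrow> (\<forall>k. pr (v k) < r k \<and> r k \<le> norm (v k)) \<and>
     (\<forall>k. f (of_real (r k) * sgn (v k)) = of_real (r (Suc k)) * sgn (v (Suc k))) \<and>
     (\<forall>k l. v k = v l \<longrightarrow> r k < r l \<longleftrightarrow> r (Suc k) < r (Suc l))"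

text \<open>If this fails, the tracking orbit may degenerate to the branching point, or to \<open>P\<close> itself.\<close>

definition genuine :: "(nat \<Rightarrow> complex) \<Rightarrow> nat \<Rightarrow> bool" where
  "genuine v N \<longleftrightarrow> \<not> (\<forall>k. pr (v k) = 0) \<and>
     \<not> (\<exists>x\<in>P. (f ^^ N) x = x \<and> (\<forall>k. sgn ((f ^^ k) x) = sgn (v k)))"

text \<open>Taking first hits makes the local inverses strictly increasing, so a periodic point of their
  composition exists by the Knaster--Tarski argument although they need not be continuous.\<close>

lemma tracking_exists:
  assumes v: "min_walk v" and N: "N > 0" and per: "\<And>k. v (k + N) = v k" and gen: "genuine v N"
  obtains r where "tracking v r" "\<And>k. r (k + N) = r k"
proof -
  have vP: "v k \<in> P" "sgn (v (Suc k)) = sgn (f (v k))" "norm (v (Suc k)) \<le> norm (f (v k))" for k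
    using v by (auto simp: min_walk_def walk_def below_def)
  define I where "I = (\<lambda>k. {pr (v k)..norm (v k)})"
  define phi where "phi = (\<lambda>k s. Inf {r \<in> {pr (v k)..norm (v k)}. level (v k) r = s})"
  have le: "pr (v k) \<le> norm (v k)" for k using pr_less[OF vP(1)[of k]] by simp
  have rng: "level (v k) (pr (v k)) \<le> s" "s \<le> level (v k) (norm (v k))" if "s \<in> I (Suc k)" for k s
    using that level_pr_le[OF v, of k] level_norm[OF vP(1)[of k]] vP(3)[of k] by (auto simp: I_def)
  have phi: "phi k s \<in> I k" "level (v k) (phi k s) = s" if "s \<in> I (Suc k)" for k s
    using first_hit[OF le continuous_on_level[OF vP(1)] rng[OF that]] by (auto simp: phi_def I_def)
  have phi_less: "phi k s < phi k s'" if "s \<in> I (Suc k)" "s' \<in> I (Suc k)" "s < s'" for k s s'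
    unfolding phi_def
    by (rule first_hit_strict_mono[OF le continuous_on_level[OF vP(1)] rng(1)[OF that(1)] that(3) rng(2)[OF that(2)]])
  have phi_mono: "phi k s \<le> phi k s'" if "s \<in> I (Suc k)" "s' \<in> I (Suc k)" "s \<le> s'" for k s s'
    using phi_less[OF that(1,2)] that(3) by (cases "s = s'") auto
  \<comment> \<open>Periodic subsolutions of \<open>s k = phi k (s (Suc k))\<close>. The lower ends
    \<open>pr (v k)\<close> form one, and the pointwise supremum is a solution because applying
    \<open>phi\<close> to it gives a subsolution again.\<close>
  define S where "S = {s. (\<forall>k. s k \<in> I k \<and> s k \<le> phi k (s (Suc k))) \<and> (\<forall>k. s (k + N) = s k)}"
  define r where "r = (\<lambda>k. Sup ((\<lambda>s. s k) ` S))"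
  have perI: "I (k + N) = I k" "phi (k + N) = phi k" for k
    by (simp_all add: I_def phi_def per)
  have "(\<lambda>k. pr (v k)) \<in> S"
    unfolding S_def using le per phi(1)[of "pr (v (Suc k))" for k] by (auto simp: I_def)
  then have Sne: "S \<noteq> {}" by blast
  have bdd: "bdd_above ((\<lambda>s. s k) ` S)" for k
    by (rule bdd_aboveI[of _ "norm (v k)"]) (auto simp: S_def I_def)
  have rge: "s k \<le> r k" if "s \<in> S" for s k
    unfolding r_def using bdd that by (auto intro: cSup_upper)
  have rle: "r k \<le> c" if "\<And>s. s \<in> S \<Longrightarrow> s k \<le> c" for k c
    unfolding r_def using Sne that by (intro cSup_least) auto
  have rI: "r k \<in> I k" for k
  proof -
    obtain s where "s \<in> S" using Sne by blast
    then have "s k \<in> I k" by (simp add: S_def)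
    then have "pr (v k) \<le> r k" using rge[OF \<open>s \<in> S\<close>, of k] by (simp add: I_def)
    moreover have "r k \<le> norm (v k)" by (rule rle) (auto simp: S_def I_def)
    ultimately show ?thesis by (simp add: I_def)
  qed
  have rN: "r (k + N) = r k" for k
  proof -
    have "(\<lambda>s. s (k + N)) ` S = (\<lambda>s. s k) ` S"
      by (rule image_cong) (simp_all add: S_def)
    then show ?thesis by (simp only: r_def)
  qed
  have r_le: "r k \<le> phi k (r (Suc k))" for k
  proof (rule rle)
    fix s assume s: "s \<in> S"
    then have "s k \<le> phi k (s (Suc k))" by (auto simp: S_def)
    also have "phi k (s (Suc k)) \<le> phi k (r (Suc k))"
      using s rI rge[OF s] by (intro phi_mono) (auto simp: S_def)
    finally show "s k \<le> phi k (r (Suc k))" .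
  qed
  have "(\<lambda>k. phi k (r (Suc k))) \<in> S"
  proof -
    have "phi k (r (Suc k)) \<le> phi k (phi (Suc k) (r (Suc (Suc k))))" for k
      using r_le rI phi(1) by (intro phi_mono) auto
    moreover have "phi (k + N) (r (Suc (k + N))) = phi k (r (Suc k))" for k
      using rN[of "Suc k"] perI by simp
    ultimately show ?thesis unfolding S_def using rI phi(1) by auto
  qed
  then have r_eq: "r k = phi k (r (Suc k))" for k
    using rge[of "\<lambda>k. phi k (r (Suc k))" k] r_le[of k] by simp
  have lev: "level (v k) (r k) = r (Suc k)" for k
    using phi(2)[OF rI] r_eq by metis
  have lift_up: "pr (v k) < r k" if "level (v k) (pr (v k)) < r (Suc k)" for k
    using that lev[of k] rI[of k] by (cases "r k = pr (v k)") (auto simp: I_def)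
  \<comment> \<open>If every lower end were mapped exactly to the next one, these ends would all be
    0 or would form an orbit in \<open>P\<close> with the itinerary of \<open>v\<close>. Both are
    excluded by \<open>genuine\<close>.\<close>
  have "\<exists>k. level (v k) (pr (v k)) < pr (v (Suc k))"
  proof (rule ccontr)
    assume "\<not> ?thesis"
    then have "pr (v (Suc k)) \<le> level (v k) (pr (v k))" for k
      by (simp add: not_less)
    then have eq: "level (v k) (pr (v k)) = pr (v (Suc k))" for k
      using level_pr_le[OF v, of k] by (intro antisym)
    have pos: "pr (v k) > 0" if "pr (v (Suc k)) > 0" for k
      using that eq[of k] pr_nonneg[of "v k"] by (cases "pr (v k) = 0") auto
    have pos': "pr (v k) > 0" if "pr (v (k + j)) > 0" for k j
      using that by (induction j) (auto dest: pos)
    obtain k0 where k0: "pr (v k0) > 0"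
      using gen pr_nonneg by (metis genuine_def order_le_less)
    have allpos: "pr (v k) > 0" for k
    proof (rule pos')
      \<comment> \<open>Positivity only propagates backwards in time, so start from a late index
        congruent to \<open>k0\<close> modulo \<open>N\<close>.\<close>
      have "k \<le> k0 + N * k" using N by (simp add: trans_le_add2)
      then have "k + (k0 + N * k - k) = k0 + N * k" by simp
      then show "pr (v (k + (k0 + N * k - k))) > 0"
        using periodic_mult[of v N, OF per] k0 by simp
    qed
    define u where "u = (\<lambda>k. of_real (pr (v k)) * sgn (v k))"
    have uP: "u k \<in> P" for k using pr_cases[of "v k"] allpos[of k] by (auto simp: u_def)
    have us: "sgn (u k) = sgn (v k)" "norm (u k) = pr (v k)" for k
      using allpos[of k] P_dirs(1)[OF vP(1)[of k]]
      by (auto simp: u_def norm_of_real_mult_dirs sgn_of_real_mult_dirs)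
    have fu: "f (u k) = u (Suc k)" for k
    proof -
      have "ret (sgn (f (v k))) (f (u k)) = pr (v (Suc k))"
        using eq[of k] by (simp add: level_def u_def)
      then have "sgn (f (u k)) = sgn (f (v k))" "norm (f (u k)) = pr (v (Suc k))"
        using allpos[of "Suc k"] P_dirs[OF f_in_P[OF uP[of k]]] P_dirs[OF f_in_P[OF vP(1)[of k]]]
        by (auto simp: ret_eq split: if_splits)
      then show ?thesis
        using us[of "Suc k"] vP(2)[of k] by (metis complex_eqI_sgn_norm)
    qed
    have "(f ^^ k) (u 0) = u k" for k
      by (induction k) (auto simp: fu)
    moreover have "u N = u 0" using per[of 0] by (simp add: u_def)
    ultimately show False
      using gen uP[of 0] us unfolding genuine_def by metis
  qed
  then obtain k0 where "level (v k0) (pr (v k0)) < pr (v (Suc k0))" by blast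
  then have k0: "pr (v k0) < r k0"
    using rI[of "Suc k0"] by (intro lift_up) (auto simp: I_def)
  have pos: "pr (v k) < r k" if "pr (v (Suc k)) < r (Suc k)" for k
    using that level_pr_le[OF v, of k] by (intro lift_up) simp
  have pos': "pr (v k) < r k" if "pr (v (k + j)) < r (k + j)" for k j
    using that by (induction j) (auto dest: pos)
  have allpos: "pr (v k) < r k" for k
  proof (rule pos')
    have "k \<le> k0 + N * k" using N by (simp add: trans_le_add2)
    then have "k + (k0 + N * k - k) = k0 + N * k" by simp
    then show "pr (v (k + (k0 + N * k - k))) < r (k + (k0 + N * k - k))"
      using periodic_mult[of v N, OF per] periodic_mult[of r N, OF rN] k0 by simp
  qed
  have "f (of_real (r k) * sgn (v k)) = of_real (r (Suc k)) * sgn (v (Suc k))" for k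
  proof -
    define q where "q = of_real (r k) * sgn (v k)"
    have rb: "0 < r k" "r k \<le> 1" for k
      using allpos[of k] pr_nonneg[of "v k"] rI[of k] P_dirs(2)[OF vP(1)[of k]] by (auto simp: I_def)
    have "q \<in> triod"
      unfolding q_def using rb[of k] P_dirs(1)[OF vP(1)] by (intro of_real_mult_dirs_in_triod) auto
    then have "f q \<in> triod" by (rule triod_maps_closed[OF maps])
    moreover have "ret (sgn (f (v k))) (f q) = r (Suc k)"
      using lev[of k] by (simp add: level_def q_def)
    ultimately have "sgn (f q) = sgn (f (v k))" "norm (f q) = r (Suc k)"
      using rb[of "Suc k"] P_dirs[OF f_in_P[OF vP(1)[of k]]] by (auto simp: ret_eq split: if_splits)
    then have "f q = of_real (r (Suc k)) * sgn (v (Suc k))"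
      using norm_mult_sgn[of "f q"] vP(2)[of k] by simp
    then show ?thesis by (simp add: q_def)
  qed
  moreover have less: "r k < r l" if kl: "v k = v l" "r (Suc k) < r (Suc l)" for k l
  proof -
    have "phi k = phi l" using kl by (simp add: phi_def)
    then have "r k = phi k (r (Suc k))" "r l = phi k (r (Suc l))" using r_eq by metis+
    moreover have "phi k (r (Suc k)) < phi k (r (Suc l))"
      unfolding phi_def
    proof (rule first_hit_strict_mono[OF le continuous_on_level[OF vP(1)] _ kl(2)])
      show "level (v k) (pr (v k)) \<le> r (Suc k)" using rng(1)[OF rI] .
      show "r (Suc l) \<le> level (v k) (norm (v k))" using rng(2)[OF rI, of l] kl by simp
    qed
    ultimately show ?thesis by simp
  qed
  moreover have "r k < r l \<longleftrightarrow> r (Suc k) < r (Suc l)" if kl: "v k = v l" for k l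
  proof -
    have "phi k = phi l" using kl by (simp add: phi_def)
    then have "r k = r l" if "r (Suc k) = r (Suc l)" using r_eq that by metis
    then show ?thesis
      using less[OF kl] less[OF kl[symmetric]]
      by (metis linorder_neqE_linordered_idom order_less_asym order_less_irrefl)
  qed
  ultimately have "tracking v r"
    unfolding tracking_def using allpos rI by (auto simp: I_def)
  then show ?thesis using that rN by blast
qed

end


section \<open>Forced patterns\<close>

lemma cycle_iso_trans:
  assumes h: "cycle_iso h f P g Q" and h': "cycle_iso h' g Q g' R"
  shows "cycle_iso (h' \<circ> h) f P g' R"
proof -
  have "h x \<in> Q" if "x \<in> P" for x
    using h that by (auto simp: cycle_iso_def bij_betw_def)
  moreover have "bij_betw (h' \<circ> h) P R"
    using h h' bij_betw_trans by (auto simp: cycle_iso_def)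
  ultimately show ?thesis
    using h h' unfolding cycle_iso_def by simp
qed

lemma cycle_iso_norm_less_iff:
  assumes h: "cycle_iso h f P g Q" and "x \<in> P" "y \<in> P" "sgn x = sgn y"
  shows "norm (h x) < norm (h y) \<longleftrightarrow> norm x < norm y"
proof
  assume l: "norm (h x) < norm (h y)"
  show "norm x < norm y"
  proof (rule ccontr)
    assume "\<not> ?thesis"
    then consider "norm y < norm x" | "norm x = norm y" by linarith
    then show False
    proof cases
      case 1
      then have "norm (h y) < norm (h x)"
        using h assms(2-4) unfolding cycle_iso_def by simp
      then show False using l by simp
    next
      case 2
      then have "x = y" using assms(4) by (rule_tac complex_eqI_sgn_norm)
      then show False using l by simp
    qed
  qed
qed (use assms in \<open>simp add: cycle_iso_def\<close>)

lemma cycle_iso_sym: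
  assumes h: "cycle_iso h f P g Q" and f: "\<And>x. x \<in> P \<Longrightarrow> f x \<in> P"
  shows "cycle_iso (the_inv_into P h) g Q f P"
proof -
  define k where "k = the_inv_into P h"
  have bij: "bij_betw h P Q" using h by (simp add: cycle_iso_def)
  have k: "k y \<in> P" "h (k y) = y" if "y \<in> Q" for y
    using bij that by (auto simp: k_def bij_betw_def f_the_inv_into_f the_inv_into_into)
  have kh: "k (h x) = x" if "x \<in> P" for x
    using bij that by (simp add: k_def bij_betw_def the_inv_into_f_f)
  have "bij_betw k Q P" unfolding k_def using bij by (rule bij_betw_the_inv_into)
  moreover have "k (g y) = f (k y) \<and> sgn (k y) = sgn y" if y: "y \<in> Q" for y
  proof -
    have "h (f (k y)) = g (h (k y))" "sgn (h (k y)) = sgn (k y)"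
      using h k(1)[OF y] by (auto simp: cycle_iso_def)
    then show ?thesis using k[OF y] kh[OF f[OF k(1)[OF y]]] by auto
  qed
  moreover have "norm (k x) < norm (k y)" if "x \<in> Q" "y \<in> Q" "sgn x = sgn y" "norm x < norm y" for x y
    using cycle_iso_norm_less_iff[OF h, of "k x" "k y"] that k calculation(2) by auto
  ultimately show ?thesis unfolding cycle_iso_def k_def[symmetric] by blast
qed

lemma cycle_equiv_refl: "(f, P) \<in> cycles \<Longrightarrow> ((f, P), (f, P)) \<in> cycle_equiv"
  unfolding cycle_equiv_def
  by (auto intro!: exI[of _ "\<lambda>x. x"] homeomorphism_ident)

lemma pattern_members_iso:
  assumes A: "A \<in> patterns" and spread: "\<And>g Q. (g, Q) \<in> A \<Longrightarrow> spread Q"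
    and "(f, P) \<in> A" "(g, Q) \<in> A"
  shows "\<exists>h. cycle_iso h f P g Q"
proof -
  obtain c where c: "A = cycle_equiv `` {c}" "c \<in> cycles"
    using A by (auto simp: patterns_def quotient_def)
  obtain f0 P0 where c0: "c = (f0, P0)" by (cases c)
  have "(f0, P0) \<in> A" using c c0 cycle_equiv_refl by auto
  then have s: "spread P0" by (rule spread)
  have "\<exists>h. cycle_iso h f0 P0 g Q" if "(g, Q) \<in> A" for g Q
    using that c c0 s spread[OF that] by (intro cycle_isoI_equiv) (auto simp: spread_def)
  then obtain h h' where h: "cycle_iso h f0 P0 f P" "cycle_iso h' f0 P0 g Q"
    using assms(3,4) by blast
  interpret cyc f0 P0 using c c0 by unfold_locales simp
  show ?thesis
    using cycle_iso_trans[OF cycle_iso_sym[OF h(1) f_in_P] h(2)] by blast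
qed

lemma pattern_members_cycles: "A \<in> patterns \<Longrightarrow> c \<in> A \<Longrightarrow> c \<in> cycles"
  by (auto simp: patterns_def quotient_def cycle_equiv_def)

lemma below_cycle_iso_iff:
  assumes "cycle_iso h f P g Q" "x \<in> P" "y \<in> P"
  shows "below (h x) (h y) \<longleftrightarrow> below x y"
proof -
  have "sgn (h x) = sgn x" "sgn (h y) = sgn y"
    using assms by (auto simp: cycle_iso_def)
  then show ?thesis
    using cycle_iso_norm_less_iff[OF assms(1,3,2)] by (auto simp: below_def not_less[symmetric])
qed

lemma funpow_cycle_iso:
  assumes h: "cycle_iso h f P g Q" and f: "\<And>x. x \<in> P \<Longrightarrow> f x \<in> P" and x: "x \<in> P"
  shows "(g ^^ k) (h x) = h ((f ^^ k) x) \<and> (f ^^ k) x \<in> P"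
proof (induction k)
  case (Suc k)
  then show ?case using h f by (simp add: cycle_iso_def)
qed (use x in simp)

locale iso_cycles = c1: cyc f P + c2: cyc g Q for f P g Q +
  fixes h
  assumes iso: "cycle_iso h f P g Q"
begin

lemma h_in: "x \<in> P \<Longrightarrow> h x \<in> Q"
  using iso by (auto simp: cycle_iso_def bij_betw_def)

lemma h_sgn: "x \<in> P \<Longrightarrow> sgn (h x) = sgn x"
  using iso by (auto simp: cycle_iso_def)

lemma h_conj: "x \<in> P \<Longrightarrow> h (f x) = g (h x)"
  using iso by (auto simp: cycle_iso_def)

lemma h_surj: "y \<in> Q \<Longrightarrow> \<exists>x\<in>P. y = h x"
  using iso by (auto simp: cycle_iso_def bij_betw_def)

lemma min_walk_h:
  assumes v: "c1.min_walk v"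
  shows "c2.min_walk (h \<circ> v)"
proof -
  have vP: "v k \<in> P" and b: "below (v (Suc k)) (f (v k))" for k
    using v by (auto simp: c1.min_walk_def c1.walk_def)
  have "below (h (v (Suc k))) (g (h (v k)))" for k
    using b[of k] below_cycle_iso_iff[OF iso vP c1.f_in_P[OF vP]] h_conj[OF vP] by metis
  moreover have "norm (h (v k)) \<le> norm z"
    if z: "z \<in> Q" "sgn z = sgn (h (v k))" "below (h (v (Suc k))) (g z)" for k z
  proof -
    obtain x where x: "x \<in> P" "z = h x" using h_surj[OF z(1)] by blast
    have "below (v (Suc k)) (f x)"
      using z(3) x below_cycle_iso_iff[OF iso vP c1.f_in_P[OF x(1)]] h_conj[OF x(1)] by metis
    moreover have s: "sgn x = sgn (v k)" using z(2) x h_sgn vP by metis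
    ultimately have "norm (v k) \<le> norm x"
      using v x(1) unfolding c1.min_walk_def by blast
    then have "below (v k) x" using s by (simp add: below_def)
    then show ?thesis
      using below_cycle_iso_iff[OF iso vP x(1)] x(2) by (metis below_def)
  qed
  ultimately show ?thesis
    unfolding c2.min_walk_def c2.walk_def using vP h_in by simp
qed

lemma pr_h_eq_0:
  assumes "x \<in> P" "c2.pr (h x) = 0"
  shows "c1.pr x = 0"
  unfolding c1.pr_eq_0_iff
proof (intro ballI impI)
  fix y assume y: "y \<in> P" "sgn y = sgn x"
  then have "norm (h x) \<le> norm (h y)"
    using assms h_in h_sgn unfolding c2.pr_eq_0_iff by simp
  then show "norm x \<le> norm y"
    using cycle_iso_norm_less_iff[OF iso y(1) assms(1) y(2)] by linarith
qed

lemma genuine_h: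
  assumes v: "c1.genuine v N" "\<And>k. v k \<in> P"
  shows "c2.genuine (h \<circ> v) N"
  unfolding c2.genuine_def
proof
  show "\<not> (\<forall>k. c2.pr ((h \<circ> v) k) = 0)"
    using v pr_h_eq_0 unfolding c1.genuine_def by auto
  show "\<not> (\<exists>y\<in>Q. (g ^^ N) y = y \<and> (\<forall>k. sgn ((g ^^ k) y) = sgn ((h \<circ> v) k)))"
  proof
    assume "\<exists>y\<in>Q. (g ^^ N) y = y \<and> (\<forall>k. sgn ((g ^^ k) y) = sgn ((h \<circ> v) k))"
    then obtain y where y: "y \<in> Q" "(g ^^ N) y = y" "\<forall>k. sgn ((g ^^ k) y) = sgn (h (v k))"
      by auto
    obtain x where x: "x \<in> P" "y = h x" using h_surj[OF y(1)] by blast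
    have gk: "(g ^^ k) y = h ((f ^^ k) x)" "(f ^^ k) x \<in> P" for k
      using funpow_cycle_iso[OF iso c1.f_in_P x(1)] x(2) by auto
    have "h ((f ^^ N) x) = h x" using y(2) gk(1)[of N] x(2) by simp
    then have "(f ^^ N) x = x"
      using iso gk(2) x(1) by (auto simp: cycle_iso_def bij_betw_def dest: inj_onD)
    moreover have "sgn ((f ^^ k) x) = sgn (v k)" for k
      using y(3)[rule_format, of k] gk[of k] h_sgn v(2) by metis
    ultimately show False using v(1) x(1) unfolding c1.genuine_def by blast
  qed
qed

end

text \<open>For different vertices on one branch the half-open intervals from
  \<open>pr (v k)\<close> to \<open>norm (v k)\<close> are disjoint, so the vertices dictate the
  order.\<close>

lemma tracking_less_iff:
  assumes "cyc f P" "cyc.tracking f P v r" "\<And>k. v k \<in> P" "sgn (v k) = sgn (v l)" "v k \<noteq> v l"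
  shows "r k < r l \<longleftrightarrow> norm (v k) < norm (v l)"
proof -
  interpret cyc f P by fact
  have b: "pr (v k) < r k" "r k \<le> norm (v k)" for k
    using assms(2) by (auto simp: tracking_def)
  have less: "r k < r l" if "sgn (v k) = sgn (v l)" "norm (v k) < norm (v l)" for k l
    using le_pr[OF assms(3)[of k] that] b(2)[of k] b(1)[of l] by linarith
  have "norm (v k) \<noteq> norm (v l)" using assms(4,5) complex_eqI_sgn_norm by blast
  then show ?thesis
    using less[of k l] less[of l k] assms(4) by (metis linorder_neqE_linordered_idom order_less_asym)
qed

text \<open>Points tracking the same itinerary cannot be ordered strictly: the order would propagate
  along the orbit and produce infinitely many different values of the periodic function \<open>r\<close>.\<close>

lemma itinerary_order:
  fixes v v' :: "nat \<Rightarrow> complex" and r r' :: "nat \<Rightarrow> real"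
  assumes N: "N > 0" and per: "\<And>k. v (k + N) = v k" "\<And>k. r (k + N) = r k" "\<And>k. r' (k + N) = r' k"
    and succ: "\<And>k l. v k = v l \<Longrightarrow> sgn (v (Suc k)) = sgn (v (Suc l))"
    and mono: "\<And>k l. v k = v l \<Longrightarrow> r k < r l \<longleftrightarrow> r (Suc k) < r (Suc l)"
    and mono': "\<And>k l. v k = v l \<Longrightarrow> r' k < r' l \<longleftrightarrow> r' (Suc k) < r' (Suc l)"
    and diff: "\<And>k l. sgn (v k) = sgn (v l) \<Longrightarrow> v k \<noteq> v l \<Longrightarrow> r k < r l \<longleftrightarrow> r' k < r' l"
    and kl: "sgn (v k) = sgn (v l)" "r k < r l"
  shows "r' k < r' l"
proof (rule ccontr)
  assume nl: "\<not> r' k < r' l"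
  \<comment> \<open>A shift with \<open>k + s\<close> congruent to \<open>l\<close> modulo
    \<open>N\<close>; the term \<open>N * k\<close> keeps the subtraction from being
    truncated.\<close>
  define s where "s = l + N * k - k"
  have "k \<le> N * k" using N by simp
  then have ks: "k + s = l + N * k" unfolding s_def by linarith
  have shift: "v (k + s) = v l" "r (k + s) = r l" "r' (k + s) = r' l"
    unfolding ks using per by (simp_all add: periodic_mult)
  have inv: "v (k + m) = v (k + s + m) \<and> r (k + m) < r (k + s + m) \<and> \<not> r' (k + m) < r' (k + s + m)" for m
  proof (induction m)
    case 0
    then show ?case using shift kl nl diff[of k l] by auto
  next
    case (Suc m)
    then have e: "v (k + m) = v (k + s + m)" and lt: "r (k + m) < r (k + s + m)"
      and ge: "\<not> r' (k + m) < r' (k + s + m)" by auto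
    have sg: "sgn (v (Suc (k + m))) = sgn (v (Suc (k + s + m)))" using succ[OF e] .
    have "\<not> r' (Suc (k + m)) < r' (Suc (k + s + m))" using mono'[OF e] ge by blast
    moreover have "r (Suc (k + m)) < r (Suc (k + s + m))" using mono[OF e] lt by blast
    ultimately show ?case using diff[OF sg] by auto
  qed
  \<comment> \<open>Each further shift by \<open>s\<close> increases \<open>r\<close>, yet
    \<open>N\<close> such shifts amount to a multiple of the period.\<close>
  have "r k < r (k + s * Suc j)" for j
  proof (induction j)
    case 0
    then show ?case using inv[of 0] by simp
  next
    case (Suc j)
    have "r (k + s * Suc j) < r (k + s + s * Suc j)" using inv by blast
    then show ?case using Suc by (simp add: ac_simps)
  qed
  moreover obtain N' where "N = Suc N'" using N by (cases N) auto
  ultimately have "r k < r (k + s * N)" by metis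
  moreover have "r (k + N * s) = r k" using per(2) by (intro periodic_mult)
  ultimately show False by (simp add: mult.commute)
qed

definition traj :: "(nat \<Rightarrow> complex) \<Rightarrow> (nat \<Rightarrow> real) \<Rightarrow> nat \<Rightarrow> complex" where
  "traj v r k = of_real (r k) * sgn (v k)"

context cyc
begin

lemma traj_props:
  assumes t: "tracking v r" and vP: "\<And>k. v k \<in> P"
  shows "sgn (traj v r k) = sgn (v k)" "norm (traj v r k) = r k" "traj v r k \<in> triod - {0}"
    "f (traj v r k) = traj v r (Suc k)" "(f ^^ j) (traj v r k) = traj v r (k + j)"
proof -
  have b: "0 < r k" "r k \<le> 1" for k
  proof -
    have "pr (v k) < r k" "r k \<le> norm (v k)" using t by (auto simp: tracking_def)
    then show "0 < r k" "r k \<le> 1"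
      using pr_nonneg[of "v k"] P_dirs(2)[OF vP[of k]] by linarith+
  qed
  have d: "sgn (v k) \<in> dirs" for k using P_dirs(1)[OF vP] .
  show "sgn (traj v r k) = sgn (v k)" "norm (traj v r k) = r k"
    using b[of k] d[of k] by (auto simp: traj_def sgn_of_real_mult_dirs norm_of_real_mult_dirs)
  then show "traj v r k \<in> triod - {0}"
    using b[of k] d[of k] by (auto simp: triod_iff)
  have step: "f (traj v r k) = traj v r (Suc k)" for k
    using t by (simp add: tracking_def traj_def)
  then show "f (traj v r k) = traj v r (Suc k)" .
  show "(f ^^ j) (traj v r k) = traj v r (k + j)"
    by (induction j) (auto simp: step)
qed

lemma traj_cycle:
  assumes t: "tracking v r" and vP: "\<And>k. v k \<in> P" and N: "N > 0"
    and per: "\<And>k. v (k + N) = v k" "\<And>k. r (k + N) = r k"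
  shows "(f, range (traj v r)) \<in> cycles"
proof -
  note tp = traj_props[OF t vP]
  have "range (traj v r) = range (\<lambda>i. (f ^^ i) (traj v r 0))"
    using tp(5)[of _ 0] by simp
  moreover have "(f ^^ N) (traj v r 0) = traj v r 0"
    using tp(5)[of N 0] per[of 0] by (simp add: traj_def)
  moreover have "traj v r 0 \<in> triod" "traj v r 0 \<noteq> 0" using tp(3)[of 0] by auto
  ultimately have "periodic_orbit f (range (traj v r))"
    unfolding periodic_orbit_def using N by blast
  moreover have "range (traj v r) \<noteq> {0}"
    using \<open>traj v r 0 \<noteq> 0\<close> by blast
  ultimately show ?thesis using maps by (simp add: cycles_def)
qed

end

context iso_cycles
begin

text \<open>Applying \<open>itinerary_order\<close> in both directions shows that the two orbits
  have the same coincidences and the same order on every branch, so matching times gives a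
  well-defined isomorphism.\<close>

lemma traj_iso:
  assumes t: "c1.tracking v r" and vP: "\<And>k. v k \<in> P" and t': "c2.tracking (h \<circ> v) r'" and N: "N > 0"
    and per: "\<And>k. v (k + N) = v k" "\<And>k. r (k + N) = r k" "\<And>k. r' (k + N) = r' k"
    and succ: "\<And>k. sgn (v (Suc k)) = sgn (f (v k))"
  shows "\<exists>\<eta>. cycle_iso \<eta> f (range (traj v r)) g (range (traj (h \<circ> v) r'))"
proof -
  have v'Q: "(h \<circ> v) k \<in> Q" for k using h_in vP by simp
  note tp = c1.traj_props[OF t vP]
  note tp' = c2.traj_props[OF t' v'Q]
  have sv: "sgn ((h \<circ> v) k) = sgn (v k)" for k using h_sgn vP by simp
  have inj: "h (v k) = h (v l) \<longleftrightarrow> v k = v l" for k l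
    using iso vP by (auto simp: cycle_iso_def bij_betw_def dest: inj_onD)
  have mono: "r k < r l \<longleftrightarrow> r (Suc k) < r (Suc l)" if "v k = v l" for k l
    using t that by (simp add: c1.tracking_def)
  have mono': "r' k < r' l \<longleftrightarrow> r' (Suc k) < r' (Suc l)" if "v k = v l" for k l
    using t' that by (simp add: c2.tracking_def)
  have diff: "r k < r l \<longleftrightarrow> r' k < r' l" if "sgn (v k) = sgn (v l)" "v k \<noteq> v l" for k l
  proof -
    have "r k < r l \<longleftrightarrow> norm (v k) < norm (v l)"
      using tracking_less_iff[OF c1.cyc_axioms t vP that] .
    moreover have "r' k < r' l \<longleftrightarrow> norm ((h \<circ> v) k) < norm ((h \<circ> v) l)"
      using that sv inj by (intro tracking_less_iff[OF c2.cyc_axioms t' v'Q]) auto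
    moreover have "norm (h (v k)) < norm (h (v l)) \<longleftrightarrow> norm (v k) < norm (v l)"
      using cycle_iso_norm_less_iff[OF iso vP vP that(1)] .
    ultimately show ?thesis by simp
  qed
  have succ': "sgn (v (Suc k)) = sgn (v (Suc l))" if "v k = v l" for k l
    using succ that by metis
  have imp1: "r' k < r' l" if "sgn (v k) = sgn (v l)" "r k < r l" for k l
    by (rule itinerary_order[of N v r r', OF N per succ' mono mono' diff that])
  have imp2: "r k < r l" if "sgn (v k) = sgn (v l)" "r' k < r' l" for k l
    by (rule itinerary_order[of N v r' r, OF N per(1,3,2) succ' mono' mono diff[symmetric] that])
  have eq: "traj (h \<circ> v) r' k = traj (h \<circ> v) r' l \<longleftrightarrow> traj v r k = traj v r l" for k l
  proof -
    have "traj v r k = traj v r l \<longleftrightarrow> sgn (v k) = sgn (v l) \<and> r k = r l"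
      using tp(1,2) by (metis complex_eqI_sgn_norm)
    moreover have "traj (h \<circ> v) r' k = traj (h \<circ> v) r' l \<longleftrightarrow> sgn (v k) = sgn (v l) \<and> r' k = r' l"
      using tp'(1,2) sv by (metis complex_eqI_sgn_norm)
    moreover have "r k = r l \<longleftrightarrow> r' k = r' l" if "sgn (v k) = sgn (v l)"
      using imp1[OF that] imp2[OF that] imp1[OF that[symmetric]] imp2[OF that[symmetric]]
      by (metis linorder_neqE_linordered_idom order_less_irrefl)
    ultimately show ?thesis by blast
  qed
  define \<eta> where "\<eta> = (\<lambda>x. traj (h \<circ> v) r' (SOME k. traj v r k = x))"
  have \<eta>: "\<eta> (traj v r k) = traj (h \<circ> v) r' k" for k
    unfolding \<eta>_def eq by (rule someI[of _ k]) simp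
  have "bij_betw \<eta> (range (traj v r)) (range (traj (h \<circ> v) r'))"
    unfolding bij_betw_def
  proof
    show "inj_on \<eta> (range (traj v r))" by (auto simp: inj_on_def \<eta> eq)
    show "\<eta> ` range (traj v r) = range (traj (h \<circ> v) r')" by (auto simp: \<eta> image_image)
  qed
  moreover have "\<eta> (f x) = g (\<eta> x) \<and> sgn (\<eta> x) = sgn x" if x: "x \<in> range (traj v r)" for x
  proof -
    obtain k where "x = traj v r k" using x by blast
    then show ?thesis by (simp only: tp(1,4) tp'(1,4) \<eta> sv simp_thms)
  qed
  moreover have "norm (\<eta> x) < norm (\<eta> y)"
    if xy: "x \<in> range (traj v r)" "y \<in> range (traj v r)" "sgn x = sgn y" "norm x < norm y" for x y
  proof -
    obtain k l where "x = traj v r k" "y = traj v r l" using xy(1,2) by blast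
    then show ?thesis
      using imp1[of k l] xy(3,4) by (simp only: tp(1,2) tp'(2) \<eta>)
  qed
  ultimately have "cycle_iso \<eta> f (range (traj v r)) g (range (traj (h \<circ> v) r'))"
    unfolding cycle_iso_def by blast
  then show ?thesis by blast
qed

end

text \<open>The pattern of a cycle that tracks a closed walk through \<open>P\<close> depends only on the walk, and
  the walk exists in every cycle with the pattern of \<open>P\<close>: hence that pattern is forced.\<close>

lemma forced_cycle:
  assumes A: "A \<in> patterns" and spread: "\<And>g Q. (g, Q) \<in> A \<Longrightarrow> spread Q" and fP: "(f, P) \<in> A"
    and w: "cyc.walk f P w" and N: "N > 0" and per: "\<And>k. w (k + N) = w k"
    and nonconst: "sgn (w i) \<noteq> sgn (w j)"
    and inner: "\<And>x. x \<in> P \<Longrightarrow> sgn x = sgn (w m) \<Longrightarrow> (\<forall>y\<in>P. sgn y = sgn x \<longrightarrow> norm x \<le> norm y) \<Longrightarrow>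
      sgn (f x) \<noteq> sgn (w (Suc m))"
    and shadow: "\<And>x. x \<in> P \<Longrightarrow> (f ^^ N) x = x \<Longrightarrow> (\<And>k. sgn ((f ^^ k) x) = sgn (w k)) \<Longrightarrow> False"
  obtains q where "(f, range q) \<in> cycles" "\<And>k. f (q k) = q (Suc k)" "\<And>k. q (k + N) = q k"
    "\<And>k. sgn (q k) = sgn (w k)" "forces A (cycle_equiv `` {(f, range q)})"
proof -
  interpret c1: cyc f P
    using pattern_members_cycles[OF A fP] by unfold_locales
  obtain v where v: "c1.min_walk v" and vs: "\<And>k. sgn (v k) = sgn (w k)" and vper: "\<And>k. v (k + N) = v k"
    using c1.min_walk_exists[OF w per] by blast
  have vP: "v k \<in> P" and succ: "sgn (v (Suc k)) = sgn (f (v k))" for k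
    using v by (auto simp: c1.min_walk_def c1.walk_def below_def)
  have "c1.pr (v m) \<noteq> 0"
    using inner[OF vP vs] succ[of m] vs[of "Suc m"] unfolding c1.pr_eq_0_iff by metis
  then have gen: "c1.genuine v N"
    unfolding c1.genuine_def using shadow vs by metis
  obtain r where r: "c1.tracking v r" and rper: "\<And>k. r (k + N) = r k"
    using c1.tracking_exists[OF v N vper gen] by blast
  note tp = c1.traj_props[OF r vP]
  have cyc1: "(f, range (traj v r)) \<in> cycles"
    using c1.traj_cycle[OF r vP N vper rper] .
  have sp: "spread (range (traj v r))"
    unfolding spread_def using tp(1,3) vs nonconst by (metis image_subsetI rangeI)
  have "forces A (cycle_equiv `` {(f, range (traj v r))})"
    unfolding forces_def
  proof (intro ballI impI)
    fix g assume "g \<in> triod_maps" "\<exists>P'. (g, P') \<in> A"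
    then obtain Q where Q: "(g, Q) \<in> A" by blast
    obtain h where h: "cycle_iso h f P g Q"
      using pattern_members_iso[OF A _ fP Q] spread by blast
    interpret iso_cycles f P g Q h
      using pattern_members_cycles[OF A Q] h by unfold_locales
    have v'P: "(h \<circ> v) k \<in> Q" for k using h_in vP by simp
    have per': "(h \<circ> v) (k + N) = (h \<circ> v) k" for k using vper by simp
    obtain r' where r': "c2.tracking (h \<circ> v) r'" and rper': "\<And>k. r' (k + N) = r' k"
      using c2.tracking_exists[OF min_walk_h[OF v] N per' genuine_h[OF gen vP]] by blast
    obtain \<eta> where \<eta>: "cycle_iso \<eta> f (range (traj v r)) g (range (traj (h \<circ> v) r'))"
      using traj_iso[OF r vP r' N vper rper rper' succ] by blast
    have cyc2: "(g, range (traj (h \<circ> v) r')) \<in> cycles"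
      using c2.traj_cycle[OF r' v'P N per' rper'] .
    interpret q1: cyc f "range (traj v r)" using cyc1 by unfold_locales
    interpret q2: cyc g "range (traj (h \<circ> v) r')" using cyc2 by unfold_locales
    show "\<exists>Q. (g, Q) \<in> cycle_equiv `` {(f, range (traj v r))}"
      using cycle_equivI_iso[OF cyc1 cyc2 q1.finite_P sp q2.in_triod \<eta>] by blast
  qed
  moreover have "traj v r (k + N) = traj v r k" for k
    by (simp add: traj_def vper rper)
  ultimately show ?thesis
    using that[of "traj v r"] cyc1 tp(1,4) vs by metis
qed


section \<open>Colours and rotation numbers\<close>

definition idx :: "(nat \<Rightarrow> complex set) \<Rightarrow> complex \<Rightarrow> nat" where
  "idx b z = (THE i. i < 3 \<and> z \<in> b i)"

text \<open>Three times the displacement; \<open>3 - idx b u\<close> stands for the negative of the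
  index modulo 3.\<close>

definition turn :: "(nat \<Rightarrow> complex set) \<Rightarrow> complex \<Rightarrow> complex \<Rightarrow> nat" where
  "turn b u v = (idx b v + (3 - idx b u)) mod 3"

locale numbering =
  fixes b :: "nat \<Rightarrow> complex set"
  assumes numbering: "branch_numbering b"
begin

lemma branch_eq_ray: "i < 3 \<Longrightarrow> \<exists>e\<in>dirs. b i = ray e"
proof -
  assume "i < 3"
  then have "b i \<in> ray ` dirs"
    using numbering by (simp only: branch_numbering_def bij_betw_def branches_eq[symmetric]) blast
  then show ?thesis by blast
qed

lemma idx_ex1:
  assumes "z \<in> triod - {0}"
  shows "\<exists>!i. i < 3 \<and> z \<in> b i"
proof -
  have "sgn z \<in> dirs" using assms by (auto intro: sgn_in_dirs)
  then have "ray (sgn z) \<in> b ` {..<3}"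
    using numbering by (auto simp: branch_numbering_def bij_betw_def branches_eq)
  then obtain i where i: "i < 3" "b i = ray (sgn z)" by auto
  have zi: "z \<in> b i" using i assms \<open>sgn z \<in> dirs\<close> by (auto simp: ray_iff)
  moreover have "j = i" if j: "j < 3" "z \<in> b j" for j
  proof -
    obtain e where e: "e \<in> dirs" "b j = ray e" using branch_eq_ray[OF j(1)] by blast
    then have "sgn z = e" using j(2) by (simp add: ray_iff)
    then have "b j = b i" using e i by simp
    then show ?thesis
      using numbering i(1) j(1) by (auto simp: branch_numbering_def bij_betw_def dest: inj_onD)
  qed
  ultimately show ?thesis using i(1) by blast
qed

lemma idx_less: "z \<in> triod - {0} \<Longrightarrow> idx b z < 3"
  and in_branch_idx: "z \<in> triod - {0} \<Longrightarrow> z \<in> b (idx b z)"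
  unfolding idx_def using theI'[OF idx_ex1] by blast+

lemma idx_eqI: "z \<in> triod - {0} \<Longrightarrow> i < 3 \<Longrightarrow> z \<in> b i \<Longrightarrow> idx b z = i"
  using idx_ex1 idx_less in_branch_idx by blast

lemma in_branch_iff_idx: "z \<in> triod - {0} \<Longrightarrow> i < 3 \<Longrightarrow> z \<in> b i \<longleftrightarrow> idx b z = i"
  using idx_eqI in_branch_idx by metis

lemma idx_eq_iff:
  assumes "z \<in> triod - {0}" "w \<in> triod - {0}"
  shows "idx b z = idx b w \<longleftrightarrow> sgn z = sgn w"
proof -
  obtain e where e: "e \<in> dirs" "b (idx b z) = ray e" using branch_eq_ray idx_less[OF assms(1)] by blast
  then have z: "sgn z = e" using in_branch_idx[OF assms(1)] by (simp add: ray_iff)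
  have "idx b z = idx b w \<longleftrightarrow> w \<in> b (idx b z)"
    using in_branch_iff_idx[OF assms(2) idx_less[OF assms(1)]] by auto
  also have "\<dots> \<longleftrightarrow> sgn w = e" using e assms(2) by (simp add: ray_iff)
  finally show ?thesis using z by auto
qed

lemma turn_less [simp]: "turn b u v < 3"
  by (simp add: turn_def)

lemma displacement_eq:
  assumes u: "u \<in> triod - {0}" and v: "v \<in> triod - {0}"
  shows "displacement b u v = real (turn b u v) / 3"
proof -
  have iu: "idx b u < 3" "idx b v < 3" using idx_less u v by auto
  have "(THE k. k < 3 \<and> (\<exists>i<3. \<exists>j<3. u \<in> b i \<and> v \<in> b j \<and> j = (i + k) mod 3)) = turn b u v"
  proof (rule the_equality)
    have "(idx b u + turn b u v) mod 3 = (idx b u + (idx b v + (3 - idx b u))) mod 3"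
      by (simp add: turn_def mod_simps)
    also have "idx b u + (idx b v + (3 - idx b u)) = idx b v + 3" using iu by simp
    finally have "idx b v = (idx b u + turn b u v) mod 3" using iu by simp
    moreover have "u \<in> b (idx b u)" "v \<in> b (idx b v)" using in_branch_idx u v by blast+
    ultimately show "turn b u v < 3 \<and> (\<exists>i<3. \<exists>j<3. u \<in> b i \<and> v \<in> b j \<and> j = (i + turn b u v) mod 3)"
      using iu by (metis turn_less)
  next
    fix k assume "k < 3 \<and> (\<exists>i<3. \<exists>j<3. u \<in> b i \<and> v \<in> b j \<and> j = (i + k) mod 3)"
    then have k: "k < 3" "idx b v = (idx b u + k) mod 3"
      using idx_eqI u v by auto
    have "turn b u v = ((idx b u + k) + (3 - idx b u)) mod 3"
      unfolding turn_def k(2) by (simp add: mod_simps)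
    also have "(idx b u + k) + (3 - idx b u) = k + 3" using iu by simp
    finally show "k = turn b u v" using k(1) by simp
  qed
  then show ?thesis by (simp add: displacement_def)
qed

lemma displacement_cong:
  assumes "u \<in> triod - {0}" "v \<in> triod - {0}" "u' \<in> triod - {0}" "v' \<in> triod - {0}"
    "sgn u = sgn u'" "sgn v = sgn v'"
  shows "displacement b u v = displacement b u' v'"
  using assms idx_eq_iff[of u u'] idx_eq_iff[of v v']
  by (simp add: displacement_eq turn_def del: Diff_iff)

lemma rotation_number_eq:
  assumes "(f, P) \<in> cycles"
  shows "rotation_number b f P = (\<Sum>x\<in>P. displacement b x (f x)) / real (card P)"
proof -
  interpret cyc f P using assms by unfold_locales
  have "(SOME x. x \<in> P) \<in> P" using P_nonempty by (simp add: some_in_eq)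
  then show ?thesis
    using sum_orbit[of "SOME x. x \<in> P" "\<lambda>x. displacement b x (f x)"]
    by (simp add: rotation_number_def rotation_pair_def Let_def)
qed

lemma rotation_number_cycle_iso:
  assumes cyc: "(f, P) \<in> cycles" "(g, Q) \<in> cycles" and h: "cycle_iso h f P g Q"
  shows "rotation_number b g Q = rotation_number b f P"
proof -
  interpret iso_cycles f P g Q h
    by (intro iso_cycles.intro cyc.intro iso_cycles_axioms.intro assms)
  have bij: "bij_betw h P Q" using h unfolding cycle_iso_def by (rule conjunct1)
  have "displacement b (h x) (g (h x)) = displacement b x (f x)" if x: "x \<in> P" for x
  proof (rule displacement_cong)
    show "sgn (g (h x)) = sgn (f x)"
      using h_conj[OF x] h_sgn[OF c1.f_in_P[OF x]] by simp
    show "g (h x) \<in> triod - {0}" using c2.f_in_P[OF h_in[OF x]] c2.in_triod by blast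
    show "f x \<in> triod - {0}" using c1.f_in_P[OF x] c1.in_triod by blast
    show "h x \<in> triod - {0}" using h_in[OF x] c2.in_triod by blast
    show "x \<in> triod - {0}" using x c1.in_triod by blast
    show "sgn (h x) = sgn x" using h_sgn[OF x] .
  qed
  then have "(\<Sum>y\<in>Q. displacement b y (g y)) = (\<Sum>x\<in>P. displacement b x (f x))"
    using sum.reindex_bij_betw[OF bij, of "\<lambda>y. displacement b y (g y)"] by simp
  then show ?thesis
    using rotation_number_eq cyc bij_betw_same_card[OF bij] by simp
qed

lemma pattern_rotation_number_eq:
  assumes "(f, P) \<in> A" "\<And>g Q. (g, Q) \<in> A \<Longrightarrow> rotation_number b g Q = rotation_number b f P"
  shows "pattern_rotation_number b A = rotation_number b f P"
proof -
  let ?rot = "\<lambda>(f, P). rotation_number b f P"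
  have "?rot c = rotation_number b f P" if "c \<in> A" for c
    using assms(2)[of "fst c" "snd c"] that by (cases c) simp
  then have "?rot ` A \<subseteq> {rotation_number b f P}" by blast
  moreover have "rotation_number b f P \<in> ?rot ` A"
    using imageI[OF assms(1), of ?rot] by simp
  ultimately have "?rot ` A = {rotation_number b f P}" by blast
  then show ?thesis by (simp add: pattern_rotation_number_def)
qed

lemma class_members_iso:
  assumes "spread Q" "(g, R) \<in> cycle_equiv `` {(f, Q)}"
  shows "(g, R) \<in> cycles" "\<exists>h. cycle_iso h f Q g R"
proof -
  have E: "((f, Q), (g, R)) \<in> cycle_equiv" using assms(2) by simp
  then show c: "(g, R) \<in> cycles" by (simp add: cycle_equiv_def)
  then interpret cyc g R by unfold_locales
  show "\<exists>h. cycle_iso h f Q g R" using cycle_isoI_equiv[OF E assms(1) in_triod] .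
qed

lemma pattern_rotation_number_class:
  assumes "(f, Q) \<in> cycles" "spread Q"
  shows "pattern_rotation_number b (cycle_equiv `` {(f, Q)}) = rotation_number b f Q"
proof (rule pattern_rotation_number_eq)
  show "(f, Q) \<in> cycle_equiv `` {(f, Q)}" using cycle_equiv_refl[OF assms(1)] by simp
  fix g R assume "(g, R) \<in> cycle_equiv `` {(f, Q)}"
  then show "rotation_number b g R = rotation_number b f Q"
    using class_members_iso[OF assms(2)] rotation_number_cycle_iso[OF assms(1)] by blast
qed

lemma canonical_spread:
  assumes "canonical_cycle b g Q" "Q \<subseteq> triod - {0}"
  shows "spread Q"
proof -
  obtain x where x: "x \<in> Q" "x \<in> b 0"
    using assms(1) unfolding canonical_cycle_def by (metis IntD1 IntD2 zero_less_numeral)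
  obtain y where y: "y \<in> Q" "y \<in> b 1"
    using assms(1) unfolding canonical_cycle_def by (metis IntD1 IntD2 one_less_numeral_iff semiring_norm(77))
  have "idx b x = 0" "idx b y = 1"
    using x y assms(2) by (auto intro!: idx_eqI)
  then have "sgn x \<noteq> sgn y"
    using idx_eq_iff[of x y] x y assms(2) by auto
  then show ?thesis using x y assms(2) unfolding spread_def by blast
qed

end

section \<open>The given twist pattern and the cycles that it forces\<close>

locale canonical_twist = numbering +
  fixes A :: triod_pattern and f :: "complex \<Rightarrow> complex" and P :: "complex set"
  assumes twist: "triod_twist b A" and canonical: "canonical_pattern b A"
    and rotation_less: "pattern_rotation_number b A < 1 / 3" and member: "(f, P) \<in> A"
begin

lemma forced_same_rotation:
  assumes "B \<in> patterns" "forces A B" "pattern_rotation_number b B = pattern_rotation_number b A"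
  shows "B = A"
proof (rule ccontr)
  assume "B \<noteq> A"
  moreover have "\<not> (\<exists>B\<in>patterns. B \<noteq> A \<and> forces A B \<and> pattern_rotation_number b B = pattern_rotation_number b A)"
    using twist unfolding triod_twist_def by (elim conjE)
  ultimately show False using assms by metis
qed

lemma A_pattern: "A \<in> patterns"
  using twist by (simp add: triod_twist_def)

sublocale cyc f P
  using pattern_members_cycles[OF A_pattern member] by unfold_locales

lemma members_spread: "(g, Q) \<in> A \<Longrightarrow> spread Q"
proof -
  assume gQ: "(g, Q) \<in> A"
  interpret c2: cyc g Q using pattern_members_cycles[OF A_pattern gQ] by unfold_locales
  have "canonical_cycle b g Q" using canonical gQ by (auto simp: canonical_pattern_def)
  then show ?thesis using canonical_spread c2.in_triod by blast
qed

definition rho :: real where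
  "rho = rotation_number b f P"

lemma members_rotation: "(g, Q) \<in> A \<Longrightarrow> rotation_number b g Q = rho"
  unfolding rho_def
  using pattern_members_iso[OF A_pattern _ member, of g Q] members_spread
    rotation_number_cycle_iso pattern_members_cycles[OF A_pattern] member by blast

lemma members_card: "(g, Q) \<in> A \<Longrightarrow> card Q = card P"
  using pattern_members_iso[OF A_pattern _ member, of g Q] members_spread bij_betw_same_card
  by (metis cycle_iso_def)

lemma A_rotation: "pattern_rotation_number b A = rho"
  using pattern_rotation_number_eq[OF member] members_rotation by (simp add: rho_def)

lemma rho_less: "rho < 1 / 3"
  using rotation_less A_rotation by simp

abbreviation ix :: "complex \<Rightarrow> nat" where "ix \<equiv> idx b"

definition col :: "complex \<Rightarrow> nat" where
  "col x = turn b x (f x)"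

lemma P_triod: "x \<in> P \<Longrightarrow> x \<in> triod - {0}"
  using in_triod by blast

lemma ix_less [simp]: "x \<in> P \<Longrightarrow> ix x < 3"
  using idx_less P_triod by blast

lemma ix_eq_iff: "x \<in> P \<Longrightarrow> y \<in> P \<Longrightarrow> ix x = ix y \<longleftrightarrow> sgn x = sgn y"
  using idx_eq_iff P_triod by blast

lemma col_less: "col x < 3"
  by (simp add: col_def)

lemma ix_f: "x \<in> P \<Longrightarrow> ix (f x) = (ix x + col x) mod 3"
proof -
  assume x: "x \<in> P"
  have "(ix x + col x) mod 3 = (ix x + (ix (f x) + (3 - ix x))) mod 3"
    by (simp add: col_def turn_def mod_simps)
  also have "ix x + (ix (f x) + (3 - ix x)) = ix (f x) + 3" using ix_less[OF x] by simp
  finally show ?thesis using ix_less[OF f_in_P[OF x]] by simp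
qed

lemma displacement_col: "x \<in> P \<Longrightarrow> displacement b x (f x) = real (col x) / 3"
  using displacement_eq P_triod f_in_P by (simp add: col_def)

lemma red_iff: "x \<in> P \<Longrightarrow> red b f x \<longleftrightarrow> col x = 2"
  by (simp add: red_def displacement_col)

lemma black_iff: "x \<in> P \<Longrightarrow> black b f x \<longleftrightarrow> col x = 1"
  by (simp add: black_def displacement_col)

lemma sum_col: "real (\<Sum>x\<in>P. col x) = 3 * rho * real (card P)"
  using rotation_number_eq[OF cycle] card_P_pos
  by (simp add: rho_def displacement_col sum_divide_distrib[symmetric])

lemma closest:
  assumes "i < 3"
  obtains p where "p \<in> P" "ix p = i" "col p = 1" "\<And>y. y \<in> P \<Longrightarrow> ix y = i \<Longrightarrow> norm p \<le> norm y"
proof -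
  have "canonical_cycle b f P" using canonical member by (auto simp: canonical_pattern_def)
  then obtain p where p: "p \<in> P" "p \<in> b i" "\<And>y. y \<in> P \<inter> b i \<Longrightarrow> dist 0 p \<le> dist 0 y" "black b f p"
    unfolding canonical_cycle_def using assms by blast
  show ?thesis
  proof
    show "p \<in> P" by fact
    show "ix p = i" using p P_triod assms by (intro idx_eqI) auto
    show "col p = 1" using p black_iff by simp
    show "norm p \<le> norm y" if "y \<in> P" "ix y = i" for y
      using p(3)[of y] that in_branch_idx[OF P_triod[OF that(1)]] by simp
  qed
qed

lemma card_ge_3: "3 \<le> card P"
proof -
  have "{..<3} \<subseteq> ix ` P"
  proof
    fix i :: nat assume "i \<in> {..<3}"
    then obtain p where "p \<in> P" "ix p = i" using closest[of i] by auto
    then show "i \<in> ix ` P" by blast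
  qed
  then have "card {..<3::nat} \<le> card (ix ` P)" by (intro card_mono) auto
  also have "\<dots> \<le> card P" by (rule card_image_le) simp
  finally show ?thesis by simp
qed

text \<open>The closest point on each branch is black. A single step of the itinerary that is not a
  turn by one therefore ensures that the minimal walk has a vertex with another point of
  \<open>P\<close> beneath it.\<close>

lemma forced_cycle_A:
  assumes w: "walk w" and N: "N > 0" and per: "\<And>k. w (k + N) = w k"
    and nonconst: "ix (w i) \<noteq> ix (w j)"
    and inner: "ix (w (Suc m)) \<noteq> (ix (w m) + 1) mod 3"
    and shadow: "\<not> (\<exists>x\<in>P. (f ^^ N) x = x \<and> (\<forall>k. ix ((f ^^ k) x) = ix (w k)))"
  obtains q where "(f, range q) \<in> cycles" "\<And>k. f (q k) = q (Suc k)" "\<And>k. q (k + N) = q k"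
    "\<And>k. sgn (q k) = sgn (w k)" "forces A (cycle_equiv `` {(f, range q)})" "spread (range q)"
    "cycle_equiv `` {(f, range q)} \<in> patterns"
proof -
  have wP: "w k \<in> P" for k using w by (simp add: walk_def)
  have nc: "sgn (w i) \<noteq> sgn (w j)" using nonconst ix_eq_iff wP by blast
  have inn: "sgn (f x) \<noteq> sgn (w (Suc m))"
    if x: "x \<in> P" "sgn x = sgn (w m)" "\<forall>y\<in>P. sgn y = sgn x \<longrightarrow> norm x \<le> norm y" for x
  proof -
    obtain p where p: "p \<in> P" "ix p = ix (w m)" "col p = 1" "\<And>y. y \<in> P \<Longrightarrow> ix y = ix (w m) \<Longrightarrow> norm p \<le> norm y"
      using closest[OF ix_less[OF wP]] by blast
    have s: "sgn p = sgn x" using p(2) x(2) ix_eq_iff[OF p(1) wP] by simp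
    then have "norm p = norm x"
      using p(4)[OF x(1)] x(2,3) p(1) ix_eq_iff[OF x(1) wP] by (simp add: antisym)
    then have "x = p" using s complex_eqI_sgn_norm by metis
    then have "ix (f x) = (ix (w m) + 1) mod 3" using ix_f[OF p(1)] p by simp
    then show ?thesis using inner ix_eq_iff[OF f_in_P[OF x(1)] wP, of "Suc m"] by metis
  qed
  have sh: False if x: "x \<in> P" "(f ^^ N) x = x" "\<And>k. sgn ((f ^^ k) x) = sgn (w k)" for x
    using shadow x ix_eq_iff[OF funpow_in_P[OF x(1)] wP] by blast
  obtain q where q: "(f, range q) \<in> cycles" "\<And>k. f (q k) = q (Suc k)" "\<And>k. q (k + N) = q k"
    "\<And>k. sgn (q k) = sgn (w k)" "forces A (cycle_equiv `` {(f, range q)})"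
    by (rule forced_cycle[OF A_pattern _ member w N per nc]) (use members_spread inn sh that in blast)+
  interpret c2: cyc f "range q" using q(1) by unfold_locales
  have "spread (range q)"
    using nc q(4) c2.in_triod unfolding spread_def by (metis rangeI)
  moreover have "cycle_equiv `` {(f, range q)} \<in> patterns"
    using q(1) unfolding patterns_def by (rule quotientI)
  ultimately show ?thesis using that q by blast
qed

text \<open>The tracking orbit would alternate between two branches and thus be a primitive cycle of
  period 2, against regularity. \<open>P\<close> has at least three points, so none of them has this
  period.\<close>

lemma no_two_loop:
  assumes x: "x \<in> P" "y \<in> P" and ne: "ix x \<noteq> ix y" and b: "below y (f x)" "below x (f y)"
  shows False
proof -
  define w where "w = (\<lambda>k::nat. if even k then x else y)"
  have w: "walk w" using x b by (auto simp: walk_def w_def)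
  have per: "w (k + 2) = w k" for k by (simp add: w_def)
  \<comment> \<open>The two turns add up to 3, so at least one of them is not a turn by one.\<close>
  define m :: nat where "m = (if ix y = (ix x + 1) mod 3 then 1 else 0)"
  have inner: "ix (w (Suc m)) \<noteq> (ix (w m) + 1) mod 3"
  proof (cases "ix y = (ix x + 1) mod 3")
    case True
    have "ix x \<noteq> ((ix x + 1) mod 3 + 1) mod 3" using ix_less[OF x(1)] by presburger
    then show ?thesis using True by (simp add: m_def w_def)
  qed (simp add: m_def w_def)
  have shadow: "(f ^^ 2) z \<noteq> z" if z: "z \<in> P" for z
  proof
    assume "(f ^^ 2) z = z"
    then have "card P dvd 2" by (rule card_dvd_period[OF z])
    then show False using card_ge_3 dvd_imp_le[of "card P" 2] by simp
  qed
  obtain q where q: "(f, range q) \<in> cycles" "\<And>k. f (q k) = q (Suc k)" "\<And>k. q (k + 2) = q k"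
    "\<And>k. sgn (q k) = sgn (w k)" "forces A (cycle_equiv `` {(f, range q)})" "spread (range q)"
    "cycle_equiv `` {(f, range q)} \<in> patterns"
  proof (rule forced_cycle_A[OF w _ per _ inner])
    show "ix (w 0) \<noteq> ix (w 1)" using ne by (simp add: w_def)
    show "\<not> (\<exists>z\<in>P. (f ^^ 2) z = z \<and> (\<forall>k. ix ((f ^^ k) z) = ix (w k)))" using shadow by blast
  qed auto
  have rq: "range q = {q 0, q 1}"
  proof
    show "range q \<subseteq> {q 0, q 1}"
    proof
      fix z assume "z \<in> range q"
      then obtain k where k: "z = q k" by blast
      have "q k = q (k mod 2)"
        using periodic_mult[of q 2 "k mod 2" "k div 2"] q(3) by simp
      then show "z \<in> {q 0, q 1}" using k by (cases "k mod 2 = 0") auto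
    qed
  qed blast
  have s: "sgn (q 0) \<noteq> sgn (q 1)"
    using q(4)[of 0] q(4)[of 1] ne ix_eq_iff[OF x] by (simp add: w_def)
  have mem: "card R = 2 \<and> primitive_cycle R" if gR: "(g, R) \<in> cycle_equiv `` {(f, range q)}" for g R
  proof -
    obtain h where h: "cycle_iso h f (range q) g R" and gRc: "(g, R) \<in> cycles"
      using class_members_iso[OF q(6) gR] by blast
    interpret c2: cyc g R using gRc by unfold_locales
    have R: "R = {h (q 0), h (q 1)}" "sgn (h (q 0)) = sgn (q 0)" "sgn (h (q 1)) = sgn (q 1)"
      using h rq by (auto simp: cycle_iso_def bij_betw_def)
    have "u = v" if c: "c \<in> branches" "u \<in> R \<inter> c" "v \<in> R \<inter> c" for c u v
    proof -
      obtain e where "e \<in> dirs" "c = ray e" using c(1) by (auto simp: branches_eq)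
      then have "sgn u = sgn v" using c by (auto simp: ray_iff)
      then show ?thesis using c R s by auto
    qed
    moreover have "h (q 0) \<noteq> h (q 1)" using R s by auto
    then have "card R = 2" using R(1) by simp
    ultimately show ?thesis unfolding primitive_cycle_def by blast
  qed
  then have "primitive_pattern (cycle_equiv `` {(f, range q)})" "has_period (cycle_equiv `` {(f, range q)}) 2"
    unfolding primitive_pattern_def has_period_def by blast+
  then show False
    using twist q(5,7) unfolding triod_twist_def regular_pattern_def by blast
qed

text \<open>The tracking cycle has the average colour of the walk, hence rotation number
  \<open>rho\<close>, and the twist property identifies its pattern with \<open>A\<close>. The later
  contradictions come from this identification.\<close>

lemma zero_loop:
  assumes w: "walk w" and N: "N > 0" and per: "\<And>k. w (k + N) = w k"
    and total: "(\<Sum>k<N. real (col (w k))) = 3 * rho * real N"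
    and nonconst: "ix (w i) \<noteq> ix (w j)"
    and inner: "ix (w (Suc m)) \<noteq> (ix (w m) + 1) mod 3"
    and shadow: "\<not> (\<exists>x\<in>P. (f ^^ N) x = x \<and> (\<forall>k. ix ((f ^^ k) x) = ix (w k)))"
  obtains q where "(f, range q) \<in> A" "\<And>k. f (q k) = q (Suc k)" "\<And>k. q (k + N) = q k"
    "\<And>k. sgn (q k) = sgn (w k)" "\<And>k. displacement b (q k) (f (q k)) = real (col (w k)) / 3"
proof -
  have wP: "w k \<in> P" for k using w by (simp add: walk_def)
  obtain q where q: "(f, range q) \<in> cycles" "\<And>k. f (q k) = q (Suc k)" "\<And>k. q (k + N) = q k"
    "\<And>k. sgn (q k) = sgn (w k)" "forces A (cycle_equiv `` {(f, range q)})" "spread (range q)"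
    "cycle_equiv `` {(f, range q)} \<in> patterns"
    using forced_cycle_A[OF w N per nonconst inner shadow] by blast
  interpret c2: cyc f "range q" using q(1) by unfold_locales
  have qk: "(f ^^ k) (q 0) = q k" for k by (induction k) (auto simp: q(2))
  have disp: "displacement b (q k) (f (q k)) = real (col (w k)) / 3" for k
  proof -
    have "displacement b (q k) (f (q k)) = displacement b (w k) (f (w k))"
    proof (rule displacement_cong)
      have "sgn (w (Suc k)) = sgn (f (w k))"
        using w by (simp add: walk_def below_def)
      then show "sgn (f (q k)) = sgn (f (w k))" using q(2,4) by simp
      show "q k \<in> triod - {0}" "f (q k) \<in> triod - {0}" using c2.in_triod q(2) by (auto simp: image_subset_iff)
      show "w k \<in> triod - {0}" "f (w k) \<in> triod - {0}" using P_triod wP f_in_P by blast+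
    qed (rule q(4))
    then show ?thesis using displacement_col wP by simp
  qed
  have "real (card (range q)) * (\<Sum>k<N. displacement b (q k) (f (q k))) =
      real N * (\<Sum>y\<in>range q. displacement b y (f y))"
    using c2.sum_period[of "q 0" N "\<lambda>y. displacement b y (f y)"] q(3)[of 0] qk by simp
  moreover have "(\<Sum>k<N. displacement b (q k) (f (q k))) = rho * real N"
    using total by (simp add: disp sum_divide_distrib[symmetric])
  ultimately have "real N * (real (card (range q)) * rho) = real N * (\<Sum>y\<in>range q. displacement b y (f y))"
    by (simp add: algebra_simps)
  then have "(\<Sum>y\<in>range q. displacement b y (f y)) = real (card (range q)) * rho"
    using N by simp
  then have "rotation_number b f (range q) = rho"
    using c2.card_P_pos by (simp add: rotation_number_eq[OF q(1)])
  then have "pattern_rotation_number b (cycle_equiv `` {(f, range q)}) = pattern_rotation_number b A"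
    using pattern_rotation_number_class[OF q(1,6)] A_rotation by simp
  then have "cycle_equiv `` {(f, range q)} = A"
    by (rule forced_same_rotation[OF q(7,5)])
  then have "(f, range q) \<in> A" using cycle_equiv_refl[OF q(1)] by auto
  then show ?thesis using that q disp by blast
qed

end


section \<open>Monotonicity of the phase\<close>

context cyc
begin

text \<open>The list omits the final vertex, so that paths compose by appending lists and a closed
  path lists exactly one period of a walk.\<close>

inductive path :: "complex \<Rightarrow> complex list \<Rightarrow> complex \<Rightarrow> bool" where
  Nil: "x \<in> P \<Longrightarrow> path x [] x"
| Cons: "x \<in> P \<Longrightarrow> below z (f x) \<Longrightarrow> path z xs y \<Longrightarrow> path x (x # xs) y"

lemma path_append: "path x xs y \<Longrightarrow> path y ys z \<Longrightarrow> path x (xs @ ys) z"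
  by (induction rule: path.induct) (auto intro: path.Cons)

text \<open>This closes up an orbit segment that ends above its starting point.\<close>

lemma path_below_end: "path x xs y \<Longrightarrow> xs \<noteq> [] \<Longrightarrow> z \<in> P \<Longrightarrow> below z y \<Longrightarrow> path x xs z"
proof (induction rule: path.induct)
  case (Cons x z' xs y)
  show ?case
  proof (cases "xs = []")
    case True
    then have "z' = y" using Cons(3) by (auto elim: path.cases)
    then have "below z (f x)" using Cons below_trans by blast
    then show ?thesis unfolding True using Cons by (intro path.Cons[OF _ _ path.Nil]) auto
  next
    case False
    then show ?thesis using Cons by (auto intro: path.Cons)
  qed
qed auto

lemma path_power: "path x xs x \<Longrightarrow> x \<in> P \<Longrightarrow> path x (concat (replicate m xs)) x"
  by (induction m) (auto intro: path.Nil path_append)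

lemma orbit_path: "x \<in> P \<Longrightarrow> path x (map (\<lambda>i. (f ^^ i) x) [0..<k]) ((f ^^ k) x)"
proof (induction k)
  case (Suc k)
  have "path ((f ^^ k) x) [(f ^^ k) x] ((f ^^ Suc k) x)"
    using path.Cons[OF _ _ path.Nil, of "(f ^^ k) x" "f ((f ^^ k) x)"] f_in_P funpow_in_P Suc.prems
    by simp
  then show ?case using path_append[OF Suc.IH[OF Suc.prems]] by simp
qed (auto intro: path.Nil)

lemma path_nth:
  "path x xs y \<Longrightarrow> i < length xs \<Longrightarrow> xs ! i \<in> P \<and> below ((xs @ [y]) ! Suc i) (f (xs ! i))"
proof (induction arbitrary: i rule: path.induct)
  case (Cons x z xs y)
  have hd: "(xs @ [y]) ! 0 = z"
    using Cons(3) by (cases rule: path.cases) auto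
  show ?case
    using Cons hd by (cases i) auto
qed auto

lemma closed_path_walk:
  assumes p: "path x xs x" and ne: "xs \<noteq> []"
  shows "walk (\<lambda>k. xs ! (k mod length xs))"
  unfolding walk_def
proof
  fix k
  define i where "i = k mod length xs"
  have i: "i < length xs" using ne by (simp add: i_def)
  have hd: "xs ! 0 = x" using p ne by (cases rule: path.cases) auto
  have "(xs @ [x]) ! Suc i = xs ! (Suc k mod length xs)"
  proof (cases "Suc i = length xs")
    case True
    then have "Suc k mod length xs = 0" by (simp add: i_def mod_Suc)
    then show ?thesis using True hd by (simp add: nth_append)
  next
    case False
    then have "Suc k mod length xs = Suc i" by (simp add: i_def mod_Suc)
    then show ?thesis using i False by (simp add: nth_append)
  qed
  then show "xs ! (k mod length xs) \<in> P \<and> below (xs ! (Suc k mod length xs)) (f (xs ! (k mod length xs)))"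
    using path_nth[OF p i] by (simp add: i_def)
qed

end

section \<open>Weights of walks and the phase function\<close>

context canonical_twist
begin

definition wt :: "complex \<Rightarrow> real" where
  "wt x = real (col x) / 3 - rho"

lemma sum_wt: "(\<Sum>x\<in>P. wt x) = 0"
  using sum_col by (simp add: wt_def sum_subtractf sum_divide_distrib[symmetric])

definition L :: "complex \<Rightarrow> real" where
  "L = (SOME L. \<forall>y\<in>P. L (f y) = L y + wt y)"

lemma L_f: "y \<in> P \<Longrightarrow> L (f y) = L y + wt y"
  using someI_ex[OF potential_exists[OF sum_wt]] unfolding L_def by blast

lemma rho_pos: "0 < rho"
proof -
  obtain p where "p \<in> P" "col p = 1" using closest[of 0] by auto
  then have "0 < (\<Sum>x\<in>P. col x)"
    by (metis finite_P less_one sum_eq_0_iff neq0_conv)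
  then have "0 < 3 * rho * real (card P)" using sum_col by (metis of_nat_0_less_iff)
  then show ?thesis by (simp add: zero_less_mult_iff)
qed

lemma sum_wt_orbit: "x \<in> P \<Longrightarrow> (\<Sum>z\<leftarrow>map (\<lambda>i. (f ^^ i) x) [0..<k]. wt z) = L ((f ^^ k) x) - L x"
  by (induction k) (auto simp: L_f funpow_in_P)

lemma col_walk:
  assumes "x \<in> P" "y \<in> P" "ix x = ix y" "ix (f x) = ix (f y)"
  shows "col x = col y"
  using assms by (simp add: col_def turn_def)

text \<open>Since \<open>0 < rho < 1/3\<close>, a closed walk of total weight zero is neither
  entirely green nor entirely black. This provides the two changes of branch that
  \<open>zero_loop\<close> asks for.\<close>

lemma zero_weight_walk:
  assumes w: "walk w" and N: "N > 0" and per: "\<And>k. w (k + N) = w k"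
    and total: "(\<Sum>k<N. wt (w k)) = 0"
    and shadow: "\<not> (\<exists>x\<in>P. (f ^^ N) x = x \<and> (\<forall>k. ix ((f ^^ k) x) = ix (w k)))"
  obtains q where "(f, range q) \<in> A" "\<And>k. f (q k) = q (Suc k)" "\<And>k. q (k + N) = q k"
    "\<And>k. displacement b (q k) (f (q k)) = real (col (w k)) / 3"
proof -
  have wP: "w k \<in> P" for k using w by (simp add: walk_def)
  have step: "ix (w (Suc k)) = (ix (w k) + col (w k)) mod 3" for k
    using w ix_eq_iff[OF wP f_in_P[OF wP], of "Suc k" k] ix_f[OF wP] by (simp add: walk_def below_def)
  have tot: "(\<Sum>k<N. real (col (w k))) = 3 * rho * real N"
    using total by (simp add: wt_def sum_subtractf sum_divide_distrib[symmetric])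
  have "\<exists>m. col (w m) \<noteq> 1"
  proof (rule ccontr)
    assume "\<not> ?thesis"
    then have "(\<Sum>k<N. real (col (w k))) = real N" by simp
    then show False using tot N rho_less by simp
  qed
  then obtain m where m: "col (w m) \<noteq> 1" by blast
  have "\<exists>i. col (w i) \<noteq> 0"
  proof (rule ccontr)
    assume "\<not> ?thesis"
    then have "(\<Sum>k<N. real (col (w k))) = 0" by simp
    then show False using tot N rho_pos by simp
  qed
  then obtain i where i: "col (w i) \<noteq> 0" by blast
  have nonconst: "ix (w (Suc i)) \<noteq> ix (w i)"
    using step[of i] i col_less[of "w i"] ix_less[OF wP[of i]] by presburger
  have inner: "ix (w (Suc m)) \<noteq> (ix (w m) + 1) mod 3"
    using step[of m] m col_less[of "w m"] ix_less[OF wP[of m]] by presburger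
  show ?thesis
    by (rule zero_loop[OF w N per tot nonconst inner shadow]) (use that in blast)+
qed

text \<open>The orbit segment closes up to a walk of length \<open>k\<close>, and the cycle tracking
  it would have pattern \<open>A\<close> but at most \<open>k < card P\<close> points.\<close>

lemma no_short_zero_loop:
  assumes x: "x \<in> P" and k: "0 < k" "k < card P" and b: "below x ((f ^^ k) x)" and eq: "L ((f ^^ k) x) = L x"
  shows False
proof -
  define xs where "xs = map (\<lambda>i. (f ^^ i) x) [0..<k]"
  have len: "length xs = k" by (simp add: xs_def)
  have ne: "xs \<noteq> []" using len k by auto
  have p: "path x xs x"
    unfolding xs_def by (rule path_below_end[OF orbit_path[OF x]]) (use k x b in auto)
  define w where "w = (\<lambda>i. xs ! (i mod k))"
  have w: "walk w" using closed_path_walk[OF p ne] by (simp add: w_def len)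
  have per: "w (i + k) = w i" for i by (simp add: w_def)
  have "(\<Sum>i<k. wt (w i)) = (\<Sum>i<k. wt (xs ! i))" by (simp add: w_def)
  also have "\<dots> = (\<Sum>z\<leftarrow>xs. wt z)" by (simp add: sum_list_sum_nth len atLeast0LessThan)
  also have "\<dots> = 0" using sum_wt_orbit[OF x, of k] eq by (simp add: xs_def)
  finally have total: "(\<Sum>i<k. wt (w i)) = 0" .
  have shadow: "\<not> (\<exists>z\<in>P. (f ^^ k) z = z \<and> (\<forall>j. ix ((f ^^ j) z) = ix (w j)))"
  proof
    assume "\<exists>z\<in>P. (f ^^ k) z = z \<and> (\<forall>j. ix ((f ^^ j) z) = ix (w j))"
    then obtain z where "z \<in> P" "(f ^^ k) z = z" by blast
    then have "card P dvd k" by (rule card_dvd_period)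
    then show False using k dvd_imp_le[of "card P" k] by simp
  qed
  obtain q where q: "(f, range q) \<in> A" "\<And>i. q (i + k) = q i"
    by (rule zero_weight_walk[OF w k(1) per total shadow]) (use that in blast)
  have "range q \<subseteq> q ` {..<k}"
  proof
    fix z assume "z \<in> range q"
    then obtain i where i: "z = q i" by blast
    have "q i = q (i mod k)" using periodic_mult[of q k "i mod k" "i div k"] q(2) by simp
    then show "z \<in> q ` {..<k}" using i k(1) by auto
  qed
  then have "card (range q) \<le> card (q ` {..<k})" by (intro card_mono) auto
  also have "\<dots> \<le> k" using card_image_le[of "{..<k}" q] by simp
  finally show False using members_card[OF q(1)] k(2) by simp
qed

text \<open>The cycle tracking a walk of weight zero must again be \<open>P\<close> up to equivalence; \<open>card P\<close>
  consecutive black points would then give it rotation number \<open>1 / 3\<close>.\<close>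

lemma no_black_run:
  assumes w: "walk w" and N: "N > 0" and per: "\<And>k. w (k + N) = w k"
    and total: "(\<Sum>k<N. wt (w k)) = 0" and black: "\<And>j. j < card P \<Longrightarrow> col (w (s + j)) = 1"
  shows False
proof -
  have wP: "w k \<in> P" for k using w by (simp add: walk_def)
  have wf: "ix (w (Suc k)) = ix (f (w k))" for k
    using w ix_eq_iff[OF wP f_in_P[OF wP]] by (simp add: walk_def below_def)
  have shadow: "\<not> (\<exists>x\<in>P. (f ^^ N) x = x \<and> (\<forall>k. ix ((f ^^ k) x) = ix (w k)))"
  proof
    assume "\<exists>x\<in>P. (f ^^ N) x = x \<and> (\<forall>k. ix ((f ^^ k) x) = ix (w k))"
    then obtain x where x: "x \<in> P" "\<And>k. ix ((f ^^ k) x) = ix (w k)" by blast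
    have c: "col ((f ^^ k) x) = col (w k)" for k
      using x(2)[of k] x(2)[of "Suc k"] wf[of k]
      by (intro col_walk[OF funpow_in_P[OF x(1)] wP]) simp_all
    have "(\<Sum>j<card P. real (col ((f ^^ j) ((f ^^ s) x)))) = (\<Sum>y\<in>P. real (col y))"
      using sum_orbit[OF funpow_in_P[OF x(1)], where D = "\<lambda>y. real (col y)"] .
    moreover have "(f ^^ j) ((f ^^ s) x) = (f ^^ (s + j)) x" for j
      by (subst add.commute) (simp add: funpow_add)
    ultimately have "(\<Sum>j<card P. real (col (w (s + j)))) = (\<Sum>y\<in>P. real (col y))"
      by (simp add: c)
    then have "real (card P) = 3 * rho * real (card P)"
      using black sum_col by simp
    then show False using card_P_pos rho_less by simp
  qed
  obtain q where q: "(f, range q) \<in> A" "\<And>k. f (q k) = q (Suc k)"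
    "\<And>k. displacement b (q k) (f (q k)) = real (col (w k)) / 3"
    by (rule zero_weight_walk[OF w N per total shadow]) (use that in blast)
  have qc: "(f, range q) \<in> cycles" using pattern_members_cycles[OF A_pattern q(1)] .
  interpret c2: cyc f "range q" using qc by unfold_locales
  have card: "card (range q) = card P" using members_card[OF q(1)] .
  have qs: "(f ^^ j) (q s) = q (s + j)" for j by (induction j) (auto simp: q(2))
  have "(\<Sum>y\<in>range q. displacement b y (f y)) = (\<Sum>j<card P. displacement b (q (s + j)) (f (q (s + j))))"
    using c2.sum_orbit[of "q s" "\<lambda>y. displacement b y (f y)"] by (simp add: card qs)
  also have "\<dots> = real (card P) / 3" using black by (simp add: q(3))
  finally have "rho = 1 / 3"
    using rotation_number_eq[OF qc] members_rotation[OF q(1)] card P_nonempty by simp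
  then show False using rho_less by simp
qed

text \<open>The weight of the walk and that of the black walk through the three closest points are integer
  multiples of \<open>1 / (3 * card P)\<close> with opposite signs, so suitable multiples of them cancel.\<close>

lemma no_negative_loop:
  assumes x: "x \<in> P" and k: "0 < k" and b: "below x ((f ^^ k) x)" and neg: "L ((f ^^ k) x) < L x"
  shows False
proof -
  define n where "n = card P"
  define S where "S = (\<Sum>x\<in>P. col x)"
  have n: "n > 0" using card_P_pos by (simp add: n_def)
  have S: "real S = 3 * rho * real n" using sum_col by (simp add: S_def n_def)
  then have "real S < real n" using rho_less n by simp
  then have Sn: "S < n" by simp
  define C1 where "C1 = map (\<lambda>i. (f ^^ i) x) [0..<k]"
  have C1: "path x C1 x"
    unfolding C1_def by (rule path_below_end[OF orbit_path[OF x]]) (use k x b in auto)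
  have w1: "(\<Sum>z\<leftarrow>C1. wt z) = L ((f ^^ k) x) - L x" unfolding C1_def by (rule sum_wt_orbit[OF x])
  define s where "s = (\<Sum>i<k. col ((f ^^ i) x))"
  have "(\<Sum>z\<leftarrow>C1. wt z) = (\<Sum>i<k. wt ((f ^^ i) x))"
    by (simp add: C1_def sum_list_sum_nth atLeast0LessThan)
  also have "\<dots> = real s / 3 - real k * rho"
    by (simp add: s_def wt_def sum_subtractf sum_divide_distrib[symmetric])
  finally have w1': "(\<Sum>z\<leftarrow>C1. wt z) = real s / 3 - real k * rho" .
  have rho: "rho = real S / (3 * real n)" using S n by simp
  have w1n: "3 * real n * (\<Sum>z\<leftarrow>C1. wt z) = real (n * s) - real (k * S)"
    unfolding w1' rho using n by (simp add: field_simps)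
  moreover have "3 * real n * (\<Sum>z\<leftarrow>C1. wt z) < 0" using w1 neg n by (simp add: mult_pos_neg)
  ultimately have "real (n * s) < real (k * S)" by linarith
  then have ks: "n * s < k * S" by (simp only: of_nat_less_iff)
  obtain p0 where p0: "p0 \<in> P" "ix p0 = 0" "col p0 = 1" "\<And>y. y \<in> P \<Longrightarrow> ix y = 0 \<Longrightarrow> norm p0 \<le> norm y"
    using closest[of 0] by auto
  obtain p1 where p1: "p1 \<in> P" "ix p1 = 1" "col p1 = 1" "\<And>y. y \<in> P \<Longrightarrow> ix y = 1 \<Longrightarrow> norm p1 \<le> norm y"
    using closest[of 1] by auto
  obtain p2 where p2: "p2 \<in> P" "ix p2 = 2" "col p2 = 1" "\<And>y. y \<in> P \<Longrightarrow> ix y = 2 \<Longrightarrow> norm p2 \<le> norm y"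
    using closest[of 2] by auto
  have below_closest: "below p (f z)"
    if "p \<in> P" "z \<in> P" "ix p = ix (f z)" "\<And>y. y \<in> P \<Longrightarrow> ix y = ix p \<Longrightarrow> norm p \<le> norm y" for p z
    using that ix_eq_iff[OF that(1) f_in_P[OF that(2)]] f_in_P[OF that(2)] by (simp add: below_def)
  have "below p1 (f p0)" "below p2 (f p1)" "below p0 (f p2)"
    using p0 p1 p2 by (auto intro!: below_closest simp: ix_f)
  then have C2: "path p0 [p0, p1, p2] p0"
    using p0(1) p1(1) p2(1) by (auto intro: path.Cons[rotated 2] path.Cons[OF _ _ path.Nil])
  have w2: "(\<Sum>z\<leftarrow>[p0, p1, p2]. wt z) = 1 - 3 * rho"
    using p0(3) p1(3) p2(3) by (simp add: wt_def)
  obtain a where a: "a < n" "p0 = (f ^^ a) x"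
    using orbit_reaches[OF x p0(1)] unfolding n_def by blast
  \<comment> \<open>A detour from \<open>x\<close> to \<open>p0\<close> and back, needed to insert
    the black triangle. Together the two pieces run once through \<open>P\<close>, so they
    contribute weight zero.\<close>
  define S1 where "S1 = map (\<lambda>i. (f ^^ i) x) [0..<a]"
  define S2 where "S2 = map (\<lambda>i. (f ^^ i) p0) [0..<n - a]"
  have S1: "path x S1 p0" unfolding S1_def a(2) by (rule orbit_path[OF x])
  have "(f ^^ (n - a)) p0 = (f ^^ (n - a + a)) x"
    unfolding a(2) by (simp only: funpow_add o_apply)
  then have return: "(f ^^ (n - a)) p0 = x"
    using a(1) funpow_card[OF x] by (simp add: n_def)
  have S2: "path p0 S2 x" using orbit_path[OF p0(1), of "n - a"] unfolding S2_def return .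
  have ws: "(\<Sum>z\<leftarrow>S1. wt z) + (\<Sum>z\<leftarrow>S2. wt z) = 0"
    unfolding S1_def S2_def sum_wt_orbit[OF x] sum_wt_orbit[OF p0(1)] return a(2)[symmetric] by simp
  \<comment> \<open>\<open>C1\<close> has weight \<open>(n * s - k * S) / (3 * n)\<close> and the
    black triangle has weight \<open>(n - S) / n\<close>, so \<open>e\<close> and \<open>c\<close>
    balance them. The common factor \<open>n\<close> in both makes \<open>c\<close> at least
    \<open>n\<close>, which yields the required run of black points.\<close>
  define e where "e = 3 * (n - S) * n"
  define c where "c = (k * S - n * s) * n"
  define X where "X = concat (replicate e C1) @ S1"
  define Y where "Y = concat (replicate c [p0, p1, p2])"
  define xs where "xs = X @ Y @ S2"
  have p: "path x xs x"
    unfolding xs_def X_def Y_def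
    by (rule path_append[OF path_append[OF path_power[OF C1 x] S1]
          path_append[OF path_power[OF C2 p0(1)] S2]])
  have sum_rep: "(\<Sum>z\<leftarrow>concat (replicate m ys). wt z) = real m * (\<Sum>z\<leftarrow>ys. wt z)" for m ys
    by (induction m) (auto simp: algebra_simps)
  have "(\<Sum>z\<leftarrow>xs. wt z) = real e * (\<Sum>z\<leftarrow>C1. wt z) + real c * (1 - 3 * rho)"
    using ws unfolding xs_def X_def Y_def by (simp only: map_append sum_list_append sum_rep w2)
  also have "\<dots> = 0"
  proof -
    have nS: "real n * (1 - 3 * rho) = real n - real S" using S by (simp add: algebra_simps)
    have "real e = (real n - real S) * (3 * real n)" "real c = (real (k * S) - real (n * s)) * real n"
      using Sn ks by (simp_all add: e_def c_def of_nat_diff)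
    then have "real e * (\<Sum>z\<leftarrow>C1. wt z) + real c * (1 - 3 * rho) =
        (real n - real S) * (3 * real n * (\<Sum>z\<leftarrow>C1. wt z)) +
        (real (k * S) - real (n * s)) * (real n * (1 - 3 * rho))"
      by (simp only: mult.assoc)
    also note nS
    finally show ?thesis unfolding w1n by (simp add: algebra_simps)
  qed
  finally have tot: "(\<Sum>z\<leftarrow>xs. wt z) = 0" .
  have lenY: "length Y = 3 * c" by (simp add: Y_def length_concat sum_list_replicate)
  have "1 \<le> k * S - n * s" using ks by linarith
  then have "1 * n \<le> c" unfolding c_def by (rule mult_le_mono1)
  then have Yn: "n \<le> length Y" using lenY by linarith
  define N where "N = length xs"
  have N: "N > 0" "length X + length Y \<le> N" using Yn n by (auto simp: N_def xs_def)
  define w where "w = (\<lambda>i. xs ! (i mod N))"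
  have w: "walk w"
    using closed_path_walk[OF p] N by (auto simp: w_def N_def)
  have per: "w (i + N) = w i" for i by (simp add: w_def)
  have "(\<Sum>i<N. wt (w i)) = (\<Sum>i<N. wt (xs ! i))" by (simp add: w_def)
  also have "\<dots> = 0" using tot by (simp add: sum_list_sum_nth N_def atLeast0LessThan)
  finally have total: "(\<Sum>i<N. wt (w i)) = 0" .
  have black: "col (w (length X + j)) = 1" if "j < card P" for j
  proof -
    have j: "j < length Y" using that Yn by (simp add: n_def)
    then have "w (length X + j) = Y ! j"
      using N(2) by (simp add: w_def xs_def nth_append)
    moreover have "Y ! j \<in> set Y" using j by (rule nth_mem)
    moreover have "set Y \<subseteq> {p0, p1, p2}" by (auto simp: Y_def)
    ultimately show ?thesis using p0(3) p1(3) p2(3) by auto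
  qed
  show False by (rule no_black_run[OF w N(1) per total black])
qed

lemma L_strict_mono:
  assumes "x \<in> P" "y \<in> P" "ix x = ix y" "norm x < norm y"
  shows "L x < L y"
proof (rule ccontr)
  assume nl: "\<not> L x < L y"
  obtain k where k: "k < card P" "y = (f ^^ k) x" using orbit_reaches[OF assms(1,2)] by blast
  have "k > 0" using k(2) assms(4) by (cases k) auto
  moreover have "below x ((f ^^ k) x)"
    using assms k(2) ix_eq_iff[OF assms(1,2)] by (simp add: below_def)
  ultimately have "L y \<noteq> L x" "\<not> L y < L x"
    using k no_short_zero_loop[OF assms(1)] no_negative_loop[OF assms(1)] by blast+
  then show False using nl by simp
qed

end


section \<open>The invariant set that excludes red points\<close>

context canonical_twist
begin

lemma below_iff_L:
  assumes "u \<in> P" "v \<in> P" "ix u = ix v"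
  shows "below u v \<longleftrightarrow> L u \<le> L v"
proof -
  have s: "sgn u = sgn v" using assms ix_eq_iff by simp
  consider "norm u < norm v" | "norm v < norm u" | "u = v"
    using complex_eqI_sgn_norm[OF s] by linarith
  then show ?thesis
    using L_strict_mono assms s by cases (force simp: below_def)+
qed

lemma wt_cases:
  shows "col x = 0 \<Longrightarrow> wt x = - rho" "col x = 1 \<Longrightarrow> wt x = 1 / 3 - rho" "col x = 2 \<Longrightarrow> wt x = 2 / 3 - rho"
  by (simp_all add: wt_def)

lemma no_red_point:
  assumes "x \<in> P"
  shows "col x \<noteq> 2"
proof
  assume "col x = 2"
  define R where "R = {x \<in> P. col x = 2}"
  have R: "finite R" "R \<noteq> {}" using assms \<open>col x = 2\<close> by (auto simp: R_def)
  define y where "y = arg_min_on L R"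
  have y: "y \<in> P" "col y = 2" and min: "\<And>z. z \<in> P \<Longrightarrow> col z = 2 \<Longrightarrow> L y \<le> L z"
    using arg_min_if_finite(1)[OF R, of L] arg_min_least[OF R, of _ L] by (auto simp: y_def R_def)
  define i where "i = ix y"
  have i: "i < 3" using y by (simp add: i_def)
  \<comment> \<open>The thresholds follow the phase of black steps starting below \<open>y\<close>.
    On the other two branches a phase bound would not suffice: the black witness \<open>v\<close> is
    kept because a red step from \<open>z\<close> returns to the branch of \<open>v\<close> and
    would close a walk of length two.\<close>
  define S where "S = (\<lambda>z. (ix z = i \<and> L z < L y) \<or>
    (ix z = (i + 1) mod 3 \<and> (\<exists>v\<in>P. ix v = i \<and> col v = 1 \<and> L v < L y \<and> below z (f v))) \<or>
    (ix z = (i + 2) mod 3 \<and>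
      (\<exists>v\<in>P. ix v = (i + 1) mod 3 \<and> col v = 1 \<and> L v < L y + (1 / 3 - rho) \<and> below z (f v))))"
  \<comment> \<open>The phase drops by \<open>rho > 0\<close> at a green point, so its image moves
    inwards.\<close>
  have green: "ix (f z) = ix z \<and> below (f z) z" if "z \<in> P" "col z = 0" for z
    using that ix_f[of z] below_iff_L[OF f_in_P[OF that(1)] that(1)] L_f wt_cases(1) rho_pos by simp
  have L_image: "L z \<le> L v + (1 / 3 - rho)" if "z \<in> P" "v \<in> P" "col v = 1" "below z (f v)" for z v
  proof -
    have "ix z = ix (f v)"
      using that ix_eq_iff[OF that(1) f_in_P[OF that(2)]] by (simp add: below_def)
    then have "L z \<le> L (f v)" using that below_iff_L[OF that(1) f_in_P[OF that(2)]] by simp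
    then show ?thesis using that L_f wt_cases(2) by simp
  qed
  have step: "S (f z)" if z: "z \<in> P" "S z" for z
  proof -
    have fz: "f z \<in> P" using f_in_P[OF z(1)] .
    consider (c0) "col z = 0" | (c1) "col z = 1" | (c2) "col z = 2"
      using col_less[of z] by linarith
    note col_cases = this
    from z(2) consider
      (S0) "ix z = i" "L z < L y"
      | (S1) v where "ix z = (i + 1) mod 3" "v \<in> P" "ix v = i" "col v = 1" "L v < L y" "below z (f v)"
      | (S2) v where "ix z = (i + 2) mod 3" "v \<in> P" "ix v = (i + 1) mod 3" "col v = 1"
          "L v < L y + (1 / 3 - rho)" "below z (f v)"
      unfolding S_def by blast
    then show ?thesis
    proof cases
      case S0
      from col_cases show ?thesis
      proof cases
        case c0
        then have "L (f z) < L y" using S0(2) L_f[OF z(1)] wt_cases(1) rho_pos by simp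
        then show ?thesis using green[OF z(1) c0] S0(1) by (simp add: S_def)
      next
        case c1
        then have "ix (f z) = (i + 1) mod 3" using ix_f[OF z(1)] S0(1) by simp
        then show ?thesis unfolding S_def using z(1) S0 c1 below_refl by blast
      next
        case c2
        then show ?thesis using min[OF z(1)] S0(2) by simp
      qed
    next
      case S1
      from col_cases show ?thesis
      proof cases
        case c0
        then show ?thesis
          unfolding S_def using green[OF z(1) c0] S1 below_trans by metis
      next
        case c1
        then have "ix (f z) = (i + 2) mod 3" using ix_f[OF z(1)] S1(1) by presburger
        moreover have "L z < L y + (1 / 3 - rho)" using L_image[OF z(1) S1(2,4,6)] S1(5) by simp
        ultimately show ?thesis unfolding S_def using z(1) S1(1) c1 below_refl by blast
      next
        case c2
        then have "ix (f z) = ix v" using ix_f[OF z(1)] S1(1,3) i by presburger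
        \<comment> \<open>A red \<open>z\<close> has \<open>L z\<close> at least \<open>L y\<close>,
          so its image has phase at least \<open>L y + 2/3 - rho\<close>, which exceeds
          \<open>L v\<close>.\<close>
        moreover have "L v \<le> L (f z)"
          using min[OF z(1) c2] S1(5) L_f[OF z(1)] wt_cases(3)[OF c2] rho_less by simp
        ultimately have "below v (f z)" using below_iff_L[OF S1(2) fz] by simp
        moreover have "ix z \<noteq> ix v" using S1(1,3) i by presburger
        ultimately show ?thesis using no_two_loop[OF z(1) S1(2)] S1(6) by blast
      qed
    next
      case S2
      have Lz: "L z < L y + 2 * (1 / 3 - rho)" using L_image[OF z(1) S2(2,4,6)] S2(5) by simp
      from col_cases show ?thesis
      proof cases
        case c0
        then show ?thesis
          unfolding S_def using green[OF z(1) c0] S2 below_trans by metis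
      next
        case c1
        have ixfz: "ix (f z) = i" using ix_f[OF z(1)] S2(1) c1 i by presburger
        show ?thesis
        proof (cases "L (f z) < L y")
          case True
          then show ?thesis using ixfz by (simp add: S_def)
        next
          case False
          \<comment> \<open>Leaving the set here would make \<open>z\<close> and \<open>y\<close> a
            closed walk of length two: \<open>f y\<close> lies on the branch of \<open>z\<close>
            with phase \<open>L y + 2/3 - rho\<close>, above the bound
            \<open>L y + 2/3 - 2 * rho\<close> for \<open>L z\<close>.\<close>
          then have "below y (f z)" using below_iff_L[OF y(1) fz] ixfz by (simp add: i_def)
          moreover have "ix (f y) = ix z" using ix_f[OF y(1)] y(2) S2(1) by (simp add: i_def)
          then have "below z (f y)"
            using below_iff_L[OF z(1) f_in_P[OF y(1)]] Lz L_f[OF y(1)] wt_cases(3)[OF y(2)] rho_pos by simp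
          moreover have "ix z \<noteq> ix y" using S2(1) i unfolding i_def by presburger
          ultimately show ?thesis using no_two_loop[OF z(1) y(1)] by blast
        qed
      next
        case c2
        then have "ix (f z) = ix v" using ix_f[OF z(1)] S2(1,3) by presburger
        moreover have "L v \<le> L (f z)"
          using min[OF z(1) c2] S2(5) L_f[OF z(1)] wt_cases(3)[OF c2] rho_less by simp
        ultimately have "below v (f z)" using below_iff_L[OF S2(2) fz] by simp
        moreover have "ix z \<noteq> ix v" using S2(1,3) by presburger
        ultimately show ?thesis using no_two_loop[OF z(1) S2(2)] S2(6) by blast
      qed
    qed
  qed
  obtain p where p: "p \<in> P" "ix p = i" "col p = 1" "\<And>z. z \<in> P \<Longrightarrow> ix z = i \<Longrightarrow> norm p \<le> norm z"
    using closest[OF i] by blast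
  have "below p y"
    using p y ix_eq_iff[OF p(1) y(1)] by (simp add: below_def i_def)
  moreover have "p \<noteq> y" using p(3) y(2) by auto
  ultimately have "norm p < norm y"
    using complex_eqI_sgn_norm[of p y] by (auto simp: below_def order_less_le)
  then have "S p" using L_strict_mono[OF p(1) y(1)] p(2) by (simp add: S_def i_def)
  then have "S ((f ^^ k) p)" for k
    by (induction k) (use p(1) in \<open>auto intro: step funpow_in_P\<close>)
  then have "S y" using orbit_reaches[OF p(1) y(1)] by metis
  moreover have "i \<noteq> (i + 1) mod 3" "i \<noteq> (i + 2) mod 3" using i by presburger+
  ultimately show False by (simp add: S_def i_def)
qed

end

theorem lemma3p8:
  fixes b :: "nat \<Rightarrow> complex set" and A :: triod_pattern
  assumes "branch_numbering b"
    and "triod_twist b A"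
    and "canonical_pattern b A"
    and "pattern_rotation_number b A < 1 / 3"
  shows "\<forall>(f, P)\<in>A. \<forall>x\<in>P. \<not> red b f x"
proof (intro ballI, clarify)
  fix f P x assume fP: "(f, P) \<in> A" and x: "x \<in> P" and red: "red b f x"
  interpret canonical_twist b A f P
    using assms fP by unfold_locales
  show False using no_red_point[OF x] red_iff[OF x] red by blast
qed

end
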